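(* Let $\Omega$ and $\Omega'$ be aperiodic repetitive tiling spaces of $\mathbb{R}^d$ with finite local complexity which are homeomorphic. Then the box-counting dimension of their canonical transversals is preserved: for any canonical transversals $\Xi\subset\Omega$ and $\Xi'\subset\Omega'$, each endowed with the restriction of the tiling distance $D$, the box-counting dimension of $\Xi$ exists if and only if that of $\Xi'$ does, and in this case $\dim_{\mathrm B}(\Xi)=\dim_{\mathrm B}(\Xi')$.
   Context: Tilings. A tile is a compact subset of $\mathbb{R}^d$ homeomorphic to a closed ball and equal to the closure of its interior (possibly decorated with a label); a prototile is an equivalence class of tiles under translation. For each tiling space a finite collection of prototiles is fixed. A tiling is a collection $T=\{t_i\}_{i\in I}$ of tiles whose translation classes are in this collection, whose union is $\mathbb{R}^d$, and such that $t_i\cap t_j$ has empty interior for $i\neq j$. For $x\in\mathbb{R}^d$, $T-x=\{t_i-x\}_{i\in I}$ (tilings are not identified with their translates). $B(x,r)$ is the ball of centre $x$ and radius $r$, and $T\cap B(x,r)$ denotes the patch of all tiles of $T$ which intersect $B(x,r)$. $T$ is aperiodic if $T-x\neq T$ for all $x\neq 0$; $T$ has finite local complexity (FLC) if for all $R>0$ there are finitely many patches $T\cap B(x,R)$, $x\in\mathbb{R}^d$, up to translation; $T$ is repetitive if for every finite patch $P\subset T$ there is $R>0$ such that a translate of $P$ appears in $T\cap B(x,R)$ for every $x\in\mathbb{R}^d$. Tiling spaces. Define a distance on tilings with the given prototiles (the "combinatorial distance") by letting $D(T_1,T_2)$ be the minimum of $1/\sqrt2$ and the infimum of all $\varepsilon>0$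 for which there are $x_1,x_2\in\mathbb{R}^d$ with $\|x_i\|\le\varepsilon$ such that $T_1-x_1$ and $T_2-x_2$ agree on $B(0,1/\varepsilon)$. The hull (tiling space) of $T$ is the closure $\Omega=\overline{\{T-x : x\in\mathbb{R}^d\}}$ for $D$; $\mathbb{R}^d$ acts continuously on it by translation. An aperiodic repetitive tiling space with FLC is the hull of an aperiodic, repetitive tiling with FLC. Transversals. A Delaunay set is a uniformly discrete and relatively dense subset of $\mathbb{R}^d$. A local pointing rule on $\Omega$ is a map $\mathcal{D}$ assigning to each $T\in\Omega$ a Delaunay set $\mathcal{D}(T)$, commuting with translations ($\mathcal{D}(T-x)=\mathcal{D}(T)-x$), and local: there are $\rho,R>0$ such that for all $T\in\Omega$, $\mathcal{D}(T)\cap B(0,\rho)$ only depends on $T\cap B(0,R)$. The canonical transversal associated with $\mathcal{D}$ is $\Xi_{\mathcal{D}}=\{T\in\Omega : 0\in\mathcal{D}(T)\}$. Box-counting dimension of a compact metric space $X$: $\dim_{\mathrm B}(X)=\lim_{\delta\to0}\log N_\delta(X)/(-\log\delta)\in[0,+\infty]$ when the limit exists, where $N_\delta(X)$ is the least number of sets of diameter at most $\delta$ needed to cover $X$. *)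

theory Defs
  imports "HOL-Analysis.Analysis"
begin

section \<open>Tiles and tilings\<close>

text \<open>
  A tile is a subset of the space together with a label; undecorated tiles are the case
  where the label type is \<^typ>\<open>unit\<close>.
\<close>

type_synonym ('a, 'l) tile = "'a set \<times> 'l"
type_synonym ('a, 'l) tiling = "('a, 'l) tile set"

definition is_tile :: "('a::euclidean_space, 'l) tile \<Rightarrow> bool" where
  "is_tile t \<longleftrightarrow>
     compact (fst t) \<and> fst t homeomorphic (cball 0 1 :: 'a set) \<and> closure (interior (fst t)) = fst t"

definition shift_tile :: "'a::euclidean_space \<Rightarrow> ('a, 'l) tile \<Rightarrow> ('a, 'l) tile" where
  "shift_tile x t = ((\<lambda>y. y - x) ` fst t, snd t)"

definition shift :: "('a::euclidean_space, 'l) tiling \<Rightarrow> 'a \<Rightarrow> ('a, 'l) tiling" where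
  "shift T x = shift_tile x ` T"

definition translation_class :: "('a::euclidean_space, 'l) tile \<Rightarrow> ('a, 'l) tile set" where
  "translation_class t = range (\<lambda>x. shift_tile x t)"

definition finite_prototile_set :: "('a::euclidean_space, 'l) tile set set \<Rightarrow> bool" where
  "finite_prototile_set P \<longleftrightarrow> finite P \<and> (\<forall>p\<in>P. \<exists>t. is_tile t \<and> p = translation_class t)"

definition tilings :: "('a::euclidean_space, 'l) tile set set \<Rightarrow> ('a, 'l) tiling set" where
  "tilings P =
     {T. (\<forall>t\<in>T. is_tile t \<and> translation_class t \<in> P) \<and>
         (\<Union>t\<in>T. fst t) = UNIV \<and>
         (\<forall>t\<in>T. \<forall>t'\<in>T. t \<noteq> t' \<longrightarrow> interior (fst t \<inter> fst t') = {})}"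

text \<open>
  \<open>patch T x r\<close> is the patch $T \cap B(x,r)$ of all tiles of \<open>T\<close> that meet \<open>B(x,r)\<close>.
  Balls are taken closed; with open balls all the notions below would be the same.
\<close>

definition patch :: "('a::euclidean_space, 'l) tiling \<Rightarrow> 'a \<Rightarrow> real \<Rightarrow> ('a, 'l) tiling" where
  "patch T x r = {t\<in>T. fst t \<inter> cball x r \<noteq> {}}"

definition aperiodic :: "('a::euclidean_space, 'l) tiling \<Rightarrow> bool" where
  "aperiodic T \<longleftrightarrow> (\<forall>x. x \<noteq> 0 \<longrightarrow> shift T x \<noteq> T)"

definition FLC :: "('a::euclidean_space, 'l) tiling \<Rightarrow> bool" where
  "FLC T \<longleftrightarrow> (\<forall>R>0. finite (range (\<lambda>x. range (\<lambda>y. shift (patch T x R) y))))"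

definition repetitive :: "('a::euclidean_space, 'l) tiling \<Rightarrow> bool" where
  "repetitive T \<longleftrightarrow>
     (\<forall>Q. Q \<subseteq> T \<and> finite Q \<longrightarrow> (\<exists>R>0. \<forall>x. \<exists>y. shift Q y \<subseteq> patch T x R))"


section \<open>Tiling spaces\<close>

text \<open>
  The infimum over \<open>\<epsilon>\<close> may range over the empty set (infimum \<open>+\<infinity>\<close>); inserting the cut-off
  $1/\sqrt{2}$ into the set yields the minimum of the two in all cases.
\<close>

definition tiling_dist ::
  "('a::euclidean_space, 'l) tiling \<Rightarrow> ('a, 'l) tiling \<Rightarrow> real" where
  "tiling_dist T1 T2 =
     Inf (insert (1 / sqrt 2)
       {\<epsilon>. \<epsilon> > 0 \<and> (\<exists>x1 x2. norm x1 \<le> \<epsilon> \<and> norm x2 \<le> \<epsilon> \<and>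
              patch (shift T1 x1) 0 (1/\<epsilon>) = patch (shift T2 x2) 0 (1/\<epsilon>))})"

definition tiling_hull ::
  "('a::euclidean_space, 'l) tile set set \<Rightarrow> ('a, 'l) tiling \<Rightarrow> ('a, 'l) tiling set" where
  "tiling_hull P T = Metric_space.mtopology (tilings P) tiling_dist closure_of range (\<lambda>x. shift T x)"

definition aperiodic_repetitive_FLC_tiling_space ::
  "('a::euclidean_space, 'l) tile set set \<Rightarrow> ('a, 'l) tiling set \<Rightarrow> bool" where
  "aperiodic_repetitive_FLC_tiling_space P \<Omega> \<longleftrightarrow>
     (\<exists>T\<in>tilings P. aperiodic T \<and> repetitive T \<and> FLC T \<and> \<Omega> = tiling_hull P T)"


section \<open>Canonical transversals\<close>

definition Delaunay :: "'a::euclidean_space set \<Rightarrow> bool" where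
  "Delaunay X \<longleftrightarrow> uniform_discrete X \<and> (\<exists>R>0. \<forall>x. \<exists>y\<in>X. dist x y \<le> R)"

definition local_pointing_rule ::
  "('a::euclidean_space, 'l) tiling set \<Rightarrow> (('a, 'l) tiling \<Rightarrow> 'a set) \<Rightarrow> bool" where
  "local_pointing_rule \<Omega> D \<longleftrightarrow>
     (\<forall>T\<in>\<Omega>. Delaunay (D T)) \<and>
     (\<forall>T\<in>\<Omega>. \<forall>x. D (shift T x) = (\<lambda>y. y - x) ` D T) \<and>
     (\<exists>\<rho>>0. \<exists>R>0. \<forall>T\<in>\<Omega>. \<forall>T'\<in>\<Omega>.
        patch T 0 R = patch T' 0 R \<longrightarrow> D T \<inter> cball 0 \<rho> = D T' \<inter> cball 0 \<rho>)"

definition canonical_transversal ::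
  "('a::euclidean_space, 'l) tiling set \<Rightarrow> (('a, 'l) tiling \<Rightarrow> 'a set) \<Rightarrow> ('a, 'l) tiling set" where
  "canonical_transversal \<Omega> D = {T\<in>\<Omega>. 0 \<in> D T}"


section \<open>Box-counting dimension\<close>

text \<open>
  These notions are meant for compact metric spaces \<open>(X, d)\<close>, where a finite cover by sets of
  diameter at most \<open>\<delta> > 0\<close> exists, so that the \<open>LEAST\<close> below is attained.
\<close>

definition covering_number :: "'b set \<Rightarrow> ('b \<Rightarrow> 'b \<Rightarrow> real) \<Rightarrow> real \<Rightarrow> nat" where
  "covering_number X d \<delta> =
     (LEAST n. \<exists>\<U>. finite \<U> \<and> card \<U> = n \<and> \<Union>\<U> = X \<and> (\<forall>U\<in>\<U>. \<forall>x\<in>U. \<forall>y\<in>U. d x y \<le> \<delta>))"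

definition box_ratio :: "'b set \<Rightarrow> ('b \<Rightarrow> 'b \<Rightarrow> real) \<Rightarrow> real \<Rightarrow> ereal" where
  "box_ratio X d \<delta> = ereal (ln (real (covering_number X d \<delta>)) / (- ln \<delta>))"

text \<open>The limit is taken in the extended reals, so the value \<open>\<infinity>\<close> counts as existing.\<close>

definition box_dim_exists :: "'b set \<Rightarrow> ('b \<Rightarrow> 'b \<Rightarrow> real) \<Rightarrow> bool" where
  "box_dim_exists X d \<longleftrightarrow> (\<exists>L. (box_ratio X d \<longlongrightarrow> L) (at_right 0))"

definition box_dim :: "'b set \<Rightarrow> ('b \<Rightarrow> 'b \<Rightarrow> real) \<Rightarrow> ereal" where
  "box_dim X d = Lim (at_right 0) (box_ratio X d)"

end

theory Submission
  imports Defs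
begin

text \<open>
  The covering numbers of a transversal count patches, and homeomorphisms of tiling spaces
  change the size of patches at most linearly. The box-counting dimension does not see
  linear changes of scale.

  In more detail, tilings in a transversal are marked at the origin, and the marked points of a
  tiling are separated; so two of them that are close agree exactly on a large ball, without the
  small displacement that the tiling distance admits (\<open>transversal_close_imp_agree\<close>). Thus on a
  transversal the distance is, up to constants, the inverse of the radius of agreement.

  Let \<open>h\<close> be a homeomorphism between the hulls. The hulls are compact
  (\<open>mcomplete_tilings\<close>, \<open>FLC_imp_mtotally_bounded_orbit\<close>), so \<open>h\<close> and its inverse are
  uniformly continuous. Tilings are rigid: small displacements between them are unique
  (\<open>displacement_eq\<close>). Consequently a small translation of \<open>T\<close> becomes a small translation of
  \<open>h T\<close>, uniformly in \<open>T\<close> (\<open>orbit_step\<close>), and translations grow at most linearly. If \<open>T1\<close> and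
  \<open>T2\<close> agree on a ball of radius \<open>R\<close>, uniform continuity makes \<open>h T1\<close> and \<open>h T2\<close> agree locally,
  up to small displacements, along all translations that stay inside this ball; by rigidity the
  displacement is the same everywhere, and \<open>h T1\<close> and \<open>h T2\<close> agree, up to this one displacement,
  on a ball of radius \<open>a * R - b\<close> (\<open>agree_image\<close>).

  A tiling in the second transversal is a bounded translate of the image of a tiling in the
  first, and the image of each patch contains a bounded number of marked points at bounded
  distance. So a cover of the first transversal at scale \<open>\<delta> / C\<close> by \<open>n\<close> sets yields a cover of
  the second at scale \<open>\<delta>\<close> by at most \<open>M * n\<close> sets (\<open>covering_number_transfer\<close>). By symmetry the
  converse estimate holds as well. The constants \<open>C\<close> and \<open>M\<close> disappear in the limit of
  logarithmic ratios (\<open>box_ratio_limit_transfer\<close>).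
\<close>

section \<open>Translations, patches and agreement\<close>

lemma shift_tile_0 [simp]: "shift_tile 0 t = t"
  by (simp add: shift_tile_def)

lemma shift_tile_shift_tile [simp]: "shift_tile y (shift_tile x t) = shift_tile (x + y) t"
  by (simp add: shift_tile_def image_image algebra_simps)

lemma shift_0 [simp]: "shift T 0 = T"
  by (simp add: shift_def)

lemma shift_shift [simp]: "shift (shift T x) y = shift T (x + y)"
  by (simp add: shift_def image_image)

lemma mem_shift_iff: "t \<in> shift T x \<longleftrightarrow> shift_tile (- x) t \<in> T"
proof
  assume "shift_tile (- x) t \<in> T"
  then have "shift_tile x (shift_tile (- x) t) \<in> shift T x"
    unfolding shift_def by (rule imageI)
  then show "t \<in> shift T x" by simp
qed (auto simp: shift_def)

lemma fst_shift_tile: "fst (shift_tile x t) = (\<lambda>y. y - x) ` fst t"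
  by (simp add: shift_tile_def)

lemma patch_shift: "patch (shift T x) c r = shift (patch T (c + x) r) x"
proof -
  have "fst (shift_tile x s) \<inter> cball c r \<noteq> {} \<longleftrightarrow> fst s \<inter> cball (c + x) r \<noteq> {}" for s :: "('a, 'b) tile"
  proof -
    have "dist c (y - x) = dist (c + x) y" for y
      by (simp add: dist_norm algebra_simps)
    then show ?thesis
      by (force simp: fst_shift_tile)
  qed
  then have "{s \<in> T. fst (shift_tile x s) \<inter> cball c r \<noteq> {}} = {s \<in> T. fst s \<inter> cball (c + x) r \<noteq> {}}"
    by blast
  moreover have "patch (shift T x) c r = shift_tile x ` {s \<in> T. fst (shift_tile x s) \<inter> cball c r \<noteq> {}}"
    unfolding patch_def shift_def by blast
  ultimately show ?thesis
    by (simp add: patch_def shift_def)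
qed

text \<open>
  Agreement on balls about the origin suffices, because agreement about another point is
  agreement of translates. For fixed radius it is an equivalence relation; these two facts
  carry most of the arguments with tilings below.
\<close>

definition agree :: "real \<Rightarrow> ('a::euclidean_space, 'l) tiling \<Rightarrow> ('a, 'l) tiling \<Rightarrow> bool" where
  "agree r S T \<longleftrightarrow> patch S 0 r = patch T 0 r"

lemma agree_refl [simp]: "agree r S S"
  by (simp add: agree_def)

lemma agree_sym: "agree r S T \<Longrightarrow> agree r T S"
  by (simp add: agree_def)

lemma agree_trans: "agree r S T \<Longrightarrow> agree r T U \<Longrightarrow> agree r S U"
  by (simp add: agree_def)

text \<open>
  A tile that meets the smaller ball meets the larger one, so the patch on the smaller ball
  can be read off from the patch on the larger one.
\<close>

lemma patch_mono:
  assumes "patch S c r = patch T c r" "dist c c' + r' \<le> r"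
  shows "patch S c' r' = patch T c' r'"
proof -
  have "cball c' r' \<subseteq> cball c r"
    using assms(2) by (metis cball_subset_cball_iff dist_commute)
  then have "patch U c' r' = {t \<in> patch U c r. fst t \<inter> cball c' r' \<noteq> {}}" for U :: "('a, 'b) tiling"
    unfolding patch_def by blast
  then show ?thesis
    using assms(1) by simp
qed

text \<open>
  The ball about \<open>v\<close> of radius \<open>r - norm v\<close> lies in the ball of radius \<open>r\<close> about the origin; a
  translation therefore costs its length in the radius of agreement.
\<close>

lemma agree_shift:
  assumes "agree r S T" "norm v + r' \<le> r"
  shows "agree r' (shift S v) (shift T v)"
proof -
  have "patch S v r' = patch T v r'"
    using assms by (simp add: patch_mono[of S 0 r T] agree_def)
  then show ?thesis
    by (simp add: agree_def patch_shift)
qed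

lemma agree_mono: "agree r S T \<Longrightarrow> r' \<le> r \<Longrightarrow> agree r' S T"
  using agree_shift[of r S T 0 r'] by simp

lemma agree_negative_radius: "r < 0 \<Longrightarrow> agree r S T"
  by (simp add: agree_def patch_def)

text \<open>
  Agreement of radius \<open>0\<close> compares the tiles that contain the origin. A tile that meets a
  ball contains some point of it, so agreement on a ball can be tested one point at a time.
\<close>

lemma agree_pointwise:
  assumes "\<And>y. norm y \<le> r \<Longrightarrow> agree 0 (shift S y) (shift T y)"
  shows "agree r S T"
proof -
  have *: "t \<in> V" if t: "t \<in> patch U 0 r" and UV: "\<And>y. norm y \<le> r \<Longrightarrow> agree 0 (shift U y) (shift V y)"
    for t and U V :: "('a, 'b) tiling"
  proof -
    obtain y where y: "y \<in> fst t" "norm y \<le> r" "t \<in> U" using t by (auto simp: patch_def)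
    have "shift_tile y t \<in> patch (shift U y) 0 0"
      using y by (auto simp: patch_def shift_def fst_shift_tile)
    then have "shift_tile y t \<in> shift V y"
      using UV[OF y(2)] by (auto simp: agree_def patch_def)
    then show ?thesis by (simp add: mem_shift_iff)
  qed
  have "t \<in> patch S 0 r \<longleftrightarrow> t \<in> patch T 0 r" for t
  proof
    assume "t \<in> patch S 0 r"
    then show "t \<in> patch T 0 r" using *[of t S T] assms by (auto simp: patch_def)
  next
    assume "t \<in> patch T 0 r"
    then show "t \<in> patch S 0 r" using *[of t T S] assms agree_sym by (auto simp: patch_def)
  qed
  then show ?thesis by (auto simp: agree_def)
qed

text \<open>
  Translating a patch is not the same as taking the patch of the translate, since the ball
  moves as well; the two agree on the ball common to both.
\<close>

lemma agree_of_patch_shift: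
  assumes "patch S 0 R = shift (patch T 0 R) v" "norm v + r \<le> R"
  shows "agree r S (shift T v)"
proof -
  have eq: "patch S 0 R = patch (shift T v) (- v) R"
    using assms(1) by (simp add: patch_shift)
  have "cball 0 r \<subseteq> cball (0::'a) R" "cball 0 r \<subseteq> cball (- v) R"
    using assms(2) norm_ge_zero[of v]
    by (auto intro!: cball_subset_cball_iff[THEN iffD2] simp: dist_norm simp del: norm_ge_zero)
  then have "patch S 0 r = {t \<in> patch S 0 R. fst t \<inter> cball 0 r \<noteq> {}}"
    "patch (shift T v) 0 r = {t \<in> patch (shift T v) (- v) R. fst t \<inter> cball 0 r \<noteq> {}}"
    unfolding patch_def by blast+
  then show ?thesis
    unfolding agree_def using eq by simp
qed

lemma agree_all_imp_eq:
  assumes "\<And>r. agree r S T" and "\<And>t. t \<in> S \<union> T \<Longrightarrow> fst t \<noteq> {}"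
  shows "S = T"
proof -
  have "t \<in> S \<longleftrightarrow> t \<in> T" for t
  proof -
    have "t \<in> U \<Longrightarrow> \<exists>r. t \<in> patch U 0 r" if "U = S \<or> U = T" for U
    proof -
      assume "t \<in> U"
      then obtain y where "y \<in> fst t" using assms(2) \<open>U = S \<or> U = T\<close> by blast
      then have "t \<in> patch U 0 (norm y)" using \<open>t \<in> U\<close> by (auto simp: patch_def)
      then show ?thesis ..
    qed
    then show ?thesis
      using assms(1) unfolding agree_def by (metis (no_types, lifting) mem_Collect_eq patch_def)
  qed
  then show ?thesis by blast
qed

section \<open>The tiling distance\<close>

lemma tiling_dist_set_bdd:
  "bdd_below (insert (1 / sqrt 2)
       {\<epsilon>. \<epsilon> > 0 \<and> (\<exists>x1 x2. norm x1 \<le> \<epsilon> \<and> norm x2 \<le> \<epsilon> \<and>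
              patch (shift T1 x1) 0 (1/\<epsilon>) = patch (shift T2 x2) 0 (1/\<epsilon>))})"
  by (rule bdd_belowI[of _ 0]) auto

lemma tiling_dist_nonneg: "0 \<le> tiling_dist S T"
  unfolding tiling_dist_def by (rule cInf_greatest) auto

lemma tiling_dist_commute: "tiling_dist S T = tiling_dist T S"
proof -
  have "(\<exists>x1 x2. norm x1 \<le> \<epsilon> \<and> norm x2 \<le> \<epsilon> \<and> patch (shift S x1) 0 (1/\<epsilon>) = patch (shift T x2) 0 (1/\<epsilon>))
    \<longleftrightarrow> (\<exists>x1 x2. norm x1 \<le> \<epsilon> \<and> norm x2 \<le> \<epsilon> \<and> patch (shift T x1) 0 (1/\<epsilon>) = patch (shift S x2) 0 (1/\<epsilon>))"
    for \<epsilon> :: real by metis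
  then show ?thesis unfolding tiling_dist_def by presburger
qed

lemma tiling_dist_le_cutoff: "tiling_dist S T \<le> 1 / sqrt 2"
  unfolding tiling_dist_def by (rule cInf_lower[OF _ tiling_dist_set_bdd]) simp

lemma tiling_dist_le:
  assumes "\<epsilon> > 0" "norm v \<le> \<epsilon>" "norm w \<le> \<epsilon>" "agree (1 / \<epsilon>) (shift S v) (shift T w)"
  shows "tiling_dist S T \<le> \<epsilon>"
  unfolding tiling_dist_def
  by (rule cInf_lower[OF _ tiling_dist_set_bdd]) (use assms in \<open>auto simp: agree_def\<close>)

lemma tiling_dist_lessE:
  assumes "tiling_dist S T < \<epsilon>" "\<epsilon> \<le> 1 / sqrt 2"
  obtains e v w where "0 < e" "e < \<epsilon>" "norm v \<le> e" "norm w \<le> e" "agree (1 / e) (shift S v) (shift T w)"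
proof -
  obtain e where "e \<in> insert (1 / sqrt 2)
       {\<epsilon>. \<epsilon> > 0 \<and> (\<exists>x1 x2. norm x1 \<le> \<epsilon> \<and> norm x2 \<le> \<epsilon> \<and>
              patch (shift S x1) 0 (1/\<epsilon>) = patch (shift T x2) 0 (1/\<epsilon>))}" "e < \<epsilon>"
    using cInf_lessD[OF _ assms(1)[unfolded tiling_dist_def]] by blast
  then show ?thesis using that assms(2) unfolding agree_def by fastforce
qed

text \<open>
  The form in which smallness of the distance is used throughout: both translations in the
  definition are moved to one side, giving a single displacement \<open>w\<close>.
\<close>

lemma tiling_dist_less_imp_agree:
  assumes "tiling_dist S T < \<epsilon>" "\<epsilon> \<le> 1 / sqrt 2"
  obtains w where "norm w \<le> 2 * \<epsilon>" "agree (1 / \<epsilon> - \<epsilon>) (shift S w) T"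
proof -
  obtain e v w where e: "0 < e" "e < \<epsilon>" "norm v \<le> e" "norm w \<le> e" "agree (1 / e) (shift S v) (shift T w)"
    by (rule tiling_dist_lessE[OF assms])
  have "1 / \<epsilon> \<le> 1 / e" using e by (simp add: frac_le)
  then have "agree (1 / \<epsilon> - \<epsilon>) (shift (shift S v) (- w)) (shift (shift T w) (- w))"
    using e by (intro agree_shift[OF e(5)]) auto
  moreover have "norm (v - w) \<le> 2 * \<epsilon>"
    using e norm_triangle_ineq4[of v w] by linarith
  ultimately show ?thesis using that[of "v - w"] by simp
qed

text \<open>
  Supplies a scale at which the preceding lemma applies, whose displacements are below a
  prescribed bound and whose radius of agreement is above another.
\<close>

lemma obtain_small_scale:
  fixes c r :: real
  assumes "c > 0"
  obtains \<epsilon> where "0 < \<epsilon>" "\<epsilon> \<le> c" "\<epsilon> \<le> 1 / sqrt 2" "\<epsilon> \<le> 1" "r \<le> 1 / \<epsilon> - \<epsilon>"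
proof
  define \<epsilon> where "\<epsilon> = min (min c (1 / sqrt 2)) (1 / (\<bar>r\<bar> + 1))"
  show \<epsilon>: "0 < \<epsilon>" "\<epsilon> \<le> c" "\<epsilon> \<le> 1 / sqrt 2" using assms by (auto simp: \<epsilon>_def)
  show e1: "\<epsilon> \<le> 1" using order_trans[OF \<epsilon>(3), of 1] by simp
  have "\<epsilon> \<le> 1 / (\<bar>r\<bar> + 1)" by (simp add: \<epsilon>_def)
  then have "\<bar>r\<bar> + 1 \<le> 1 / \<epsilon>" using \<epsilon>(1) by (simp add: field_simps)
  then show "r \<le> 1 / \<epsilon> - \<epsilon>" using e1 by linarith
qed

lemma tiling_dist_refl: "tiling_dist S S = 0"
proof (rule antisym)
  show "tiling_dist S S \<le> 0"
    by (rule field_le_epsilon) (use tiling_dist_le[of _ 0 0 S S] in auto)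
qed (rule tiling_dist_nonneg)

text \<open>
  The translations add up, and each comparison loses the length of the other one's
  translation in its radius. The inequality \<open>p + 1 / (p + q) \<le> 1 / q\<close> for \<open>p + q \<le> 1\<close> absorbs
  this loss; the cut-off $1/\sqrt{2}$ keeps the scales in this range.
\<close>

lemma tiling_dist_triangle: "tiling_dist S U \<le> tiling_dist S T + tiling_dist T U"
proof (cases "tiling_dist S T + tiling_dist T U < 1 / sqrt 2")
  case False
  then show ?thesis using tiling_dist_le_cutoff[of S U] by linarith
next
  case True
  have *: "tiling_dist S U \<le> tiling_dist S T + tiling_dist T U + \<eta>"
    if "\<eta> > 0" "tiling_dist S T + tiling_dist T U + \<eta> < 1 / sqrt 2" for \<eta>
  proof -
    have st: "tiling_dist S T + \<eta> / 2 \<le> 1 / sqrt 2" "tiling_dist T U + \<eta> / 2 \<le> 1 / sqrt 2"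
      using that tiling_dist_nonneg[of S T] tiling_dist_nonneg[of T U] by linarith+
    obtain a v w where a: "0 < a" "a < tiling_dist S T + \<eta> / 2" "norm v \<le> a" "norm w \<le> a"
        "agree (1 / a) (shift S v) (shift T w)"
      by (rule tiling_dist_lessE[OF _ st(1)]) (use \<open>\<eta> > 0\<close> in auto)
    obtain b x y where b: "0 < b" "b < tiling_dist T U + \<eta> / 2" "norm x \<le> b" "norm y \<le> b"
        "agree (1 / b) (shift T x) (shift U y)"
      by (rule tiling_dist_lessE[OF _ st(2)]) (use \<open>\<eta> > 0\<close> in auto)
    have ab: "a + b < 1 / sqrt 2" using a b that by linarith
    have "1 / sqrt 2 \<le> (1::real)" by simp
    then have ab1: "a + b \<le> 1" using ab by linarith
    have key: "p + 1 / (p + q) \<le> 1 / q" if "p > 0" "q > 0" "p + q \<le> 1" for p q :: real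
    proof -
      have "q * (p + q) \<le> 1"
        using that mult_le_one[of q "p + q"] by auto
      then have "p * (q * (p + q)) \<le> p" using that mult_left_le[of "q * (p+q)" p] by auto
      then show ?thesis using that by (simp add: field_simps)
    qed
    have "agree (1 / (a + b)) (shift (shift S v) x) (shift (shift T w) x)"
      using a b key[of b a] ab1 by (intro agree_shift[OF a(5)]) (auto simp: add.commute)
    moreover have "agree (1 / (a + b)) (shift (shift T x) w) (shift (shift U y) w)"
      using a b key[of a b] ab1 by (intro agree_shift[OF b(5)]) (auto simp: add.commute)
    ultimately have "agree (1 / (a + b)) (shift S (v + x)) (shift U (y + w))"
      by (simp add: add.commute agree_trans)
    moreover have "norm (v + x) \<le> a + b" "norm (y + w) \<le> a + b"
      using a b norm_triangle_ineq[of v x] norm_triangle_ineq[of y w] by linarith+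
    ultimately have "tiling_dist S U \<le> a + b"
      using a b tiling_dist_le[of "a + b"] by simp
    then show ?thesis using a b by linarith
  qed
  show ?thesis
  proof (rule field_le_epsilon)
    fix \<eta> :: real assume "\<eta> > 0"
    obtain \<theta> where "0 < \<theta>" "\<theta> < min \<eta> (1 / sqrt 2 - (tiling_dist S T + tiling_dist T U))"
      using True \<open>\<eta> > 0\<close> dense[of 0 "min \<eta> (1 / sqrt 2 - (tiling_dist S T + tiling_dist T U))"] by auto
    then have "\<theta> > 0" "\<theta> \<le> \<eta>" "tiling_dist S T + tiling_dist T U + \<theta> < 1 / sqrt 2"
      by auto
    then show "tiling_dist S U \<le> tiling_dist S T + tiling_dist T U + \<eta>"
      using *[of \<theta>] by linarith
  qed
qed

lemma tiling_dist_shift: "tiling_dist S (shift S x) \<le> norm x"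
proof (cases "x = 0")
  case False
  then show ?thesis
    using tiling_dist_le[of "norm x" x 0 S "shift S x"] by simp
qed (simp add: tiling_dist_refl)

section \<open>Rigidity of tilings\<close>

lemma translation_class_shift_tile [simp]: "translation_class (shift_tile x t) = translation_class t"
proof -
  have "shift_tile y t \<in> range (\<lambda>y. shift_tile (x + y) t)" for y
    by (rule image_eqI[of _ _ "y - x"]) auto
  then show ?thesis
    unfolding translation_class_def shift_tile_shift_tile by auto
qed

lemma is_tile_shift_tile [simp]:
  fixes t :: "('a::euclidean_space, 'l) tile"
  assumes t: "is_tile t"
  shows "is_tile (shift_tile x t)"
proof -
  have "fst t homeomorphic (\<lambda>y. - x + y) ` fst t"
    by (rule homeomorphic_translation)
  then have "(\<lambda>y. y - x) ` fst t homeomorphic fst t"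
    by (subst homeomorphic_sym) simp
  then have "(\<lambda>y. y - x) ` fst t homeomorphic (cball 0 1 :: 'a set)"
    using t homeomorphic_trans unfolding is_tile_def by blast
  then show ?thesis
    using t unfolding is_tile_def fst_shift_tile
    by (simp add: interior_translation_subtract closure_translation_subtract
        compact_translation_subtract)
qed

lemma is_tile_nonempty: "is_tile t \<Longrightarrow> fst t \<noteq> {}"
  by (auto simp: is_tile_def homeomorphic_empty)

lemma tilingsD:
  assumes "T \<in> tilings P"
  shows "t \<in> T \<Longrightarrow> is_tile t" "t \<in> T \<Longrightarrow> translation_class t \<in> P" "\<exists>t\<in>T. y \<in> fst t"
    "t \<in> T \<Longrightarrow> t' \<in> T \<Longrightarrow> t \<noteq> t' \<Longrightarrow> interior (fst t \<inter> fst t') = {}"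
proof -
  have "y \<in> (\<Union>t\<in>T. fst t)" using assms by (simp add: tilings_def)
  then show "\<exists>t\<in>T. y \<in> fst t" by blast
qed (use assms in \<open>simp_all add: tilings_def del: interior_Int\<close>)

lemma shift_in_tilings [simp]:
  assumes "T \<in> tilings P"
  shows "shift T x \<in> tilings P"
proof -
  have "(\<Union>t\<in>shift T x. fst t) = (\<lambda>y. y - x) ` (\<Union>t\<in>T. fst t)"
    by (auto simp: shift_def fst_shift_tile)
  also have "\<dots> = UNIV"
    using assms by (simp add: tilings_def)
  finally have "(\<Union>t\<in>shift T x. fst t) = UNIV" .
  moreover have "interior (fst (shift_tile x t) \<inter> fst (shift_tile x t')) = {}"
    if "t \<in> T" "t' \<in> T" "shift_tile x t \<noteq> shift_tile x t'" for t t'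
  proof -
    have "interior (fst t \<inter> fst t') = {}"
      using that by (intro tilingsD(4)[OF assms]) auto
    moreover have "fst (shift_tile x t) \<inter> fst (shift_tile x t') = (\<lambda>y. y - x) ` (fst t \<inter> fst t')"
      by (simp add: fst_shift_tile image_Int)
    ultimately show ?thesis
      by (simp add: interior_translation_subtract)
  qed
  moreover have "is_tile t \<and> translation_class t \<in> P" if "t \<in> shift T x" for t
    using that tilingsD(1,2)[OF assms] by (auto simp: shift_def)
  ultimately show ?thesis
    unfolding tilings_def shift_def by blast
qed

text \<open>
  No tile of a tiling can slide by less than \<open>\<kappa>\<close> onto a tile of the same tiling. This is the
  discreteness that makes small displacements between tilings unique.
\<close>

definition rigid :: "real \<Rightarrow> ('a::euclidean_space, 'l) tiling set \<Rightarrow> bool" where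
  "rigid \<kappa> X \<longleftrightarrow> \<kappa> > 0 \<and>
     (\<forall>T\<in>X. \<forall>t\<in>T. \<forall>v. shift_tile v t \<in> T \<longrightarrow> norm v < \<kappa> \<longrightarrow> v = 0)"

text \<open>
  Finitely many prototiles share a positive inner radius \<open>\<kappa>\<close>. If a tile and its translate by less
  than \<open>\<kappa>\<close> both belong to a tiling, the centre of an inscribed ball is interior to both, so the
  two tiles coincide; a nonempty compact set is not invariant under a nonzero translation.
\<close>

lemma tilings_rigid:
  fixes P :: "('a::euclidean_space, 'l) tile set set"
  assumes "finite_prototile_set P"
  shows "\<exists>\<kappa>. rigid \<kappa> (tilings P)"
proof -
  have "\<exists>e>0. \<forall>t. translation_class t = p \<longrightarrow> (\<exists>c. ball c e \<subseteq> fst t)" if "p \<in> P" for p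
  proof -
    obtain t where t: "is_tile t" "p = translation_class t"
      using assms \<open>p \<in> P\<close> unfolding finite_prototile_set_def by blast
    have "interior (fst t) \<noteq> {}"
      using t(1) is_tile_nonempty[OF t(1)] by (auto simp: is_tile_def)
    then obtain c e where e: "e > 0" "ball c e \<subseteq> fst t"
      by (meson equals0I mem_interior)
    have "\<exists>c. ball c e \<subseteq> fst s" if "translation_class s = p" for s
    proof -
      have "s \<in> translation_class s"
        unfolding translation_class_def by (rule image_eqI[of _ _ 0]) auto
      then have "s \<in> translation_class t" using that t(2) by simp
      then obtain x where "s = shift_tile x t"
        unfolding translation_class_def by blast
      moreover have "ball (c - x) e = (\<lambda>y. y - x) ` ball c e"
        by (rule ball_translation_subtract)
      ultimately have "ball (c - x) e \<subseteq> fst s"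
        using e(2) by (auto simp: fst_shift_tile)
      then show ?thesis ..
    qed
    then show ?thesis using e(1) by blast
  qed
  then obtain e where e: "\<And>p. p \<in> P \<Longrightarrow> e p > (0::real)"
    "\<And>p t. p \<in> P \<Longrightarrow> translation_class t = p \<Longrightarrow> \<exists>c. ball c (e p) \<subseteq> fst t"
    by metis
  define \<kappa> where "\<kappa> = Min (insert 1 (e ` P))"
  have fin: "finite P" using assms by (simp add: finite_prototile_set_def)
  have \<kappa>: "\<kappa> > 0" "\<And>p. p \<in> P \<Longrightarrow> \<kappa> \<le> e p"
    using fin e(1) by (auto simp: \<kappa>_def)
  have "v = 0" if T: "T \<in> tilings P" "t \<in> T" "shift_tile v t \<in> T" "norm v < \<kappa>" for T t v
  proof -
    have tc: "translation_class t \<in> P" "is_tile t" using tilingsD[OF T(1)] T(2) by auto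
    obtain c where "ball c (e (translation_class t)) \<subseteq> fst t"
      using e(2)[OF tc(1) refl] by blast
    then have c: "ball c \<kappa> \<subseteq> fst t"
      using \<kappa>(2)[OF tc(1)] by (meson subset_ball subset_trans)
    then have "ball (c - v) \<kappa> \<subseteq> fst (shift_tile v t)"
      unfolding fst_shift_tile ball_translation_subtract by (rule image_mono)
    then have "ball c \<kappa> \<inter> ball (c - v) \<kappa> \<subseteq> interior (fst t \<inter> fst (shift_tile v t))"
      using c by (intro interior_maximal) auto
    moreover have "c \<in> ball c \<kappa> \<inter> ball (c - v) \<kappa>"
      using T(4) \<kappa>(1) by (simp add: dist_norm)
    ultimately have "t = shift_tile v t"
      using tilingsD(4)[OF T(1-3)] by blast
    then have eq: "fst t = (\<lambda>y. y - v) ` fst t"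
      by (metis fst_shift_tile)
    have "compact (fst t)" "fst t \<noteq> {}"
      using tc(2) is_tile_nonempty[OF tc(2)] by (auto simp: is_tile_def)
    then have "\<exists>y\<in>fst t. \<forall>z\<in>fst t. v \<bullet> y \<le> v \<bullet> z"
      by (intro continuous_attains_inf continuous_intros) auto
    then obtain y where y: "y \<in> fst t" "\<And>z. z \<in> fst t \<Longrightarrow> v \<bullet> y \<le> v \<bullet> z"
      by blast
    \<comment> \<open>A lowest point in direction \<open>v\<close> would be beaten by its own translate.\<close>
    have "y - v \<in> fst t" using eq y(1) by blast
    then have "v \<bullet> v \<le> 0" using y(2)[of "y - v"] by (simp add: inner_diff_right)
    then show ?thesis by (metis antisym inner_eq_zero_iff inner_ge_zero)
  qed
  then show ?thesis using \<kappa>(1) unfolding rigid_def by blast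
qed

text \<open>
  The radius \<open>\<kappa>\<close> is carried as a parameter of the locale, together with its rigidity,
  so that all smallness requirements below can be measured against it.
\<close>

locale prototiles =
  fixes P :: "('a::euclidean_space, 'l) tile set set" and \<kappa> :: real
  assumes rigid: "rigid \<kappa> (tilings P)"
begin

lemma \<kappa>_pos: "\<kappa> > 0"
  using rigid by (simp add: rigid_def)

text \<open>
  Two displacements that both match \<open>T\<close> with \<open>S\<close> near the origin bring two tiles of \<open>T\<close> onto the
  same tile of \<open>S\<close>; by rigidity they are equal as soon as they are close.
\<close>

lemma displacement_eq:
  assumes "S \<in> tilings P" "T \<in> tilings P"
    and "agree r (shift T a) S" "0 \<le> r" "agree s (shift T b) S" "0 \<le> s"
    and "norm (a - b) < \<kappa>"
  shows "a = b"
proof -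
  obtain t where t: "t \<in> S" "0 \<in> fst t"
    using tilingsD(3)[OF assms(1)] by blast
  then have "t \<in> patch S 0 0" by (auto simp: patch_def)
  then have "t \<in> patch (shift T a) 0 0" "t \<in> patch (shift T b) 0 0"
    using agree_mono[OF assms(3,4)] agree_mono[OF assms(5,6)] by (auto simp: agree_def)
  then have "shift_tile (- a) t \<in> T" "shift_tile (a - b) (shift_tile (- a) t) \<in> T"
    by (auto simp: patch_def mem_shift_iff)
  then show ?thesis
    using rigid assms(2,7) unfolding rigid_def by fastforce
qed

text \<open>
  Cocycle property of small displacements: with \<open>S0\<close> as a common reference, the displacements
  of \<open>S\<close> and \<open>S'\<close> towards \<open>S0\<close> differ exactly by the displacement from \<open>S\<close> to \<open>S'\<close>. It turns
  approximate closeness of tilings into exact agreement of their displaced copies.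
\<close>

lemma displacement_add:
  assumes "S \<in> tilings P" "S' \<in> tilings P" "S0 \<in> tilings P"
    and "agree r (shift S a) S0" "0 \<le> r" "agree s (shift S' b) S0" "0 \<le> s"
    and "agree R (shift S u) S'" "norm b \<le> R" "norm a + norm b + norm u < \<kappa>"
  shows "a = u + b"
proof -
  have "agree 0 (shift (shift S u) b) (shift S' b)"
    using assms by (intro agree_shift[OF assms(8)]) auto
  then have "agree 0 (shift S (u + b)) S0"
    using agree_mono[OF assms(6,7)] agree_trans by auto
  moreover have "norm (a - (u + b)) < \<kappa>"
    using assms(10) norm_triangle_ineq4[of a "u + b"] norm_triangle_ineq[of u b] by linarith
  ultimately show ?thesis
    using displacement_eq[OF assms(3,1,4,5)] by blast
qed

lemma tile_nonempty: "T \<in> tilings P \<Longrightarrow> t \<in> T \<Longrightarrow> fst t \<noteq> {}"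
  using is_tile_nonempty tilingsD(1) by blast

text \<open>
  The displacement at a fixed scale is, by uniqueness, the displacement at every smaller
  scale; hence it vanishes, and the tilings agree on all balls.
\<close>

lemma tiling_dist_zero_imp_eq:
  assumes "S \<in> tilings P" "T \<in> tilings P" "tiling_dist S T = 0"
  shows "S = T"
proof -
  define c where "c = min (1 / sqrt 2) (\<kappa> / 5)"
  have c: "0 < c" "c \<le> 1 / sqrt 2" "c \<le> \<kappa> / 5" using \<kappa>_pos by (auto simp: c_def)
  have c1: "c \<le> 1" using c(2) order_trans[of c "1 / sqrt 2" 1] by simp
  have ge: "0 \<le> 1 / \<epsilon> - \<epsilon>" if "0 < \<epsilon>" "\<epsilon> \<le> c" for \<epsilon>
  proof -
    have "\<epsilon> * \<epsilon> \<le> 1" using that c1 by (simp add: mult_le_one)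
    then show ?thesis using that by (simp add: field_simps)
  qed
  have ex: "\<exists>w. norm w \<le> 2 * \<epsilon> \<and> agree (1 / \<epsilon> - \<epsilon>) (shift S w) T" if "0 < \<epsilon>" "\<epsilon> \<le> c" for \<epsilon>
  proof -
    have "tiling_dist S T < \<epsilon>" "\<epsilon> \<le> 1 / sqrt 2" using assms(3) that c(2) by auto
    then show ?thesis by (rule tiling_dist_less_imp_agree) blast
  qed
  obtain w0 where w0: "norm w0 \<le> 2 * c" "agree (1 / c - c) (shift S w0) T"
    using ex[of c] c by auto
  have w0': "norm w0 \<le> 2 * \<epsilon> \<and> agree (1 / \<epsilon> - \<epsilon>) (shift S w0) T" if \<epsilon>: "0 < \<epsilon>" "\<epsilon> \<le> c" for \<epsilon>
  proof -
    obtain w where w: "norm w \<le> 2 * \<epsilon>" "agree (1 / \<epsilon> - \<epsilon>) (shift S w) T" using ex[OF \<epsilon>] by auto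
    have "norm (w0 - w) < \<kappa>"
      using w0(1) w(1) \<epsilon> c norm_triangle_ineq4[of w0 w] by linarith
    moreover have "0 \<le> 1 / c - c" "0 \<le> 1 / \<epsilon> - \<epsilon>" using ge \<epsilon> c by auto
    ultimately have "w0 = w"
      using displacement_eq[OF assms(2,1) w0(2) _ w(2)] by simp
    then show ?thesis using w by simp
  qed
  have "norm w0 \<le> \<epsilon>" if "\<epsilon> > 0" for \<epsilon>
    using w0'[of "min c (\<epsilon> / 2)"] that c(1) by auto
  then have "w0 = 0"
    by (meson dense_ge leD not_le norm_le_zero_iff)
  have "agree r S T" for r
  proof -
    define \<epsilon> where "\<epsilon> = min c (1 / (\<bar>r\<bar> + 1))"
    have \<epsilon>: "0 < \<epsilon>" "\<epsilon> \<le> c" "\<epsilon> \<le> 1 / (\<bar>r\<bar> + 1)" using c by (auto simp: \<epsilon>_def)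
    have "\<bar>r\<bar> + 1 \<le> 1 / \<epsilon>" using \<epsilon> by (simp add: field_simps)
    then have "r \<le> 1 / \<epsilon> - \<epsilon>" using \<epsilon> c1 by linarith
    then show ?thesis using w0'[OF \<epsilon>(1,2)] \<open>w0 = 0\<close> agree_mono by auto
  qed
  then show ?thesis
    using assms tile_nonempty by (intro agree_all_imp_eq) auto
qed

lemma Metric_space_tilings: "Metric_space (tilings P) tiling_dist"
  by unfold_locales
    (auto simp: tiling_dist_nonneg tiling_dist_commute tiling_dist_refl tiling_dist_triangle
      dest: tiling_dist_zero_imp_eq)

sublocale Metric_space "tilings P" tiling_dist
  by (rule Metric_space_tilings)

section \<open>Completeness of the space of tilings\<close>

text \<open>
  Late members of a Cauchy sequence have unique small displacements \<open>w n\<close> towards one fixed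
  member. The displaced tilings \<open>\<tau> n\<close> are eventually constant on every ball and so have a
  tile-by-tile limit, while the vectors \<open>w n\<close> converge; undoing the limit displacement gives the
  limit of the sequence.
\<close>

lemma mcomplete_tilings: mcomplete
  unfolding mcomplete_def
proof (intro allI impI)
  fix \<sigma> assume "MCauchy \<sigma>"
  then have \<sigma>: "\<And>n. \<sigma> n \<in> tilings P"
    and cau: "\<And>\<epsilon>. \<epsilon> > 0 \<Longrightarrow> \<exists>N. \<forall>m\<ge>N. \<forall>n\<ge>N. tiling_dist (\<sigma> m) (\<sigma> n) < \<epsilon>"
    unfolding MCauchy_def by (blast, metis)
  \<comment> \<open>Three displacements, each of length at most \<open>2 * c\<close>, have to add up to less than \<open>\<kappa>\<close>.\<close>
  define c where "c = min (1 / 2) (\<kappa> / 7)"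
  have c: "0 < c" "c \<le> 1 / 2" "c \<le> \<kappa> / 7" using \<kappa>_pos by (auto simp: c_def)
  have "sqrt 2 \<le> 2" using real_le_lsqrt[of 2 2] by simp
  then have "1 / 2 \<le> 1 / sqrt 2" by (simp add: field_simps)
  then have csq: "c \<le> 1 / sqrt 2" using c by linarith
  obtain n0 where n0: "\<And>m n. m \<ge> n0 \<Longrightarrow> n \<ge> n0 \<Longrightarrow> tiling_dist (\<sigma> m) (\<sigma> n) < c"
    using cau[OF c(1)] by blast
  have "\<exists>w. norm w \<le> 2 * c \<and> agree (1 / c - c) (shift (\<sigma> n) w) (\<sigma> n0)" if "n \<ge> n0" for n
    by (rule tiling_dist_less_imp_agree[OF n0[OF that order_refl] csq]) blast
  then obtain w where w: "\<And>n. n \<ge> n0 \<Longrightarrow> norm (w n) \<le> 2 * c"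
    "\<And>n. n \<ge> n0 \<Longrightarrow> agree (1 / c - c) (shift (\<sigma> n) (w n)) (\<sigma> n0)"
    by metis
  define \<tau> where "\<tau> n = shift (\<sigma> n) (w n)" for n
  have inv_ge: "1 / \<epsilon> - \<epsilon> \<ge> 1" if "0 < \<epsilon>" "\<epsilon> \<le> c" for \<epsilon>
  proof -
    have "2 \<le> 1 / \<epsilon>" using that c by (simp add: field_simps)
    then show ?thesis using that c by linarith
  qed
  have A: "\<exists>N\<ge>n0. \<forall>m\<ge>N. \<forall>n\<ge>N. norm (w m - w n) \<le> 2 * \<epsilon> \<and> agree (1 / \<epsilon> - 2) (\<tau> m) (\<tau> n)"
    if \<epsilon>: "0 < \<epsilon>" "\<epsilon> \<le> c" for \<epsilon>
  proof -
    obtain N where N: "\<And>m n. m \<ge> N \<Longrightarrow> n \<ge> N \<Longrightarrow> tiling_dist (\<sigma> m) (\<sigma> n) < \<epsilon>"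
      using cau[OF \<epsilon>(1)] by blast
    have "norm (w m - w n) \<le> 2 * \<epsilon> \<and> agree (1 / \<epsilon> - 2) (\<tau> m) (\<tau> n)"
      if mn: "m \<ge> max N n0" "n \<ge> max N n0" for m n
    proof -
      have "tiling_dist (\<sigma> m) (\<sigma> n) < \<epsilon>" "\<epsilon> \<le> 1 / sqrt 2" using N mn \<epsilon> csq by simp_all
      then obtain u where u: "norm u \<le> 2 * \<epsilon>" "agree (1 / \<epsilon> - \<epsilon>) (shift (\<sigma> m) u) (\<sigma> n)"
        by (rule tiling_dist_less_imp_agree)
      have wmn: "norm (w m) \<le> 2 * c" "norm (w n) \<le> 2 * c" using w(1) mn by auto
      have "w m = u + w n"
      proof (rule displacement_add[OF \<sigma>[of m] \<sigma>[of n] \<sigma>[of n0] _ _ _ _ u(2)])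
        show "agree (1 / c - c) (shift (\<sigma> m) (w m)) (\<sigma> n0)"
             "agree (1 / c - c) (shift (\<sigma> n) (w n)) (\<sigma> n0)"
          using w(2) mn by auto
        show "0 \<le> 1 / c - c" "0 \<le> 1 / c - c" using inv_ge[of c] c by auto
        show "norm (w n) \<le> 1 / \<epsilon> - \<epsilon>" using inv_ge[OF \<epsilon>] wmn c by linarith
        show "norm (w m) + norm (w n) + norm u < \<kappa>" using wmn u(1) \<epsilon> c \<kappa>_pos by linarith
      qed
      moreover have "agree (1 / \<epsilon> - 2) (shift (shift (\<sigma> m) u) (w n)) (\<tau> n)"
        unfolding \<tau>_def using wmn \<epsilon> c by (intro agree_shift[OF u(2)]) auto
      ultimately show ?thesis using u by (simp add: \<tau>_def)
    qed
    then show ?thesis by (intro exI[of _ "max N n0"]) auto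
  qed
  have small: "\<exists>\<epsilon>>0. \<epsilon> \<le> c \<and> \<epsilon> \<le> \<eta> \<and> r \<le> 1 / \<epsilon> - 2" if "\<eta> > 0" for \<eta> r
  proof -
    define \<epsilon> where "\<epsilon> = min (min c \<eta>) (1 / (\<bar>r\<bar> + 2))"
    have \<epsilon>: "0 < \<epsilon>" "\<epsilon> \<le> c" "\<epsilon> \<le> \<eta>" "\<epsilon> \<le> 1 / (\<bar>r\<bar> + 2)" using c that by (auto simp: \<epsilon>_def)
    have "\<bar>r\<bar> + 2 \<le> 1 / \<epsilon>" using \<epsilon> by (simp add: field_simps)
    then show ?thesis using \<epsilon> by (intro exI[of _ \<epsilon>]) auto
  qed
  have "Cauchy w"
    unfolding Cauchy_iff
  proof (intro allI impI)
    fix e :: real assume "e > 0"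
    then obtain \<epsilon> where \<epsilon>: "\<epsilon> > 0" "\<epsilon> \<le> c" "\<epsilon> \<le> e / 3" using small[of "e / 3"] by auto
    then have "2 * \<epsilon> < e" by linarith
    then show "\<exists>M. \<forall>m\<ge>M. \<forall>n\<ge>M. norm (w m - w n) < e" using A[OF \<epsilon>(1,2)] by (meson le_less_trans)
  qed
  then obtain l where l: "w \<longlonglongrightarrow> l" using Cauchy_convergent convergent_def by metis
  define T where "T = {t. \<exists>N. \<forall>n\<ge>N. t \<in> \<tau> n}"
  have \<tau>: "\<tau> n \<in> tilings P" for n by (simp add: \<tau>_def \<sigma>)
  have B: "\<exists>N. \<forall>n\<ge>N. agree r (\<tau> n) T" for r
  proof -
    obtain \<epsilon> where \<epsilon>: "\<epsilon> > 0" "\<epsilon> \<le> c" "r \<le> 1 / \<epsilon> - 2" using small[of 1 r] by auto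
    obtain N where N: "\<And>m n. m \<ge> N \<Longrightarrow> n \<ge> N \<Longrightarrow> agree (1 / \<epsilon> - 2) (\<tau> m) (\<tau> n)"
      using A[OF \<epsilon>(1,2)] by blast
    then have pe: "patch (\<tau> m) 0 r = patch (\<tau> n) 0 r" if "m \<ge> N" "n \<ge> N" for m n
      using agree_mono[OF _ \<epsilon>(3)] that unfolding agree_def by blast
    have "patch (\<tau> n) 0 r = patch T 0 r" if n: "n \<ge> N" for n
    proof (intro equalityI subsetI)
      fix t assume "t \<in> patch (\<tau> n) 0 r"
      then have "\<forall>m\<ge>N. t \<in> patch (\<tau> m) 0 r" using pe n by metis
      then show "t \<in> patch T 0 r" unfolding patch_def T_def by blast
    next
      fix t assume t: "t \<in> patch T 0 r"
      then obtain M where "\<And>m. m \<ge> M \<Longrightarrow> t \<in> \<tau> m" by (auto simp: patch_def T_def)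
      then have "t \<in> patch (\<tau> (max M N)) 0 r" using t by (auto simp: patch_def)
      then show "t \<in> patch (\<tau> n) 0 r" using pe[of "max M N" n] n by simp
    qed
    then show ?thesis by (auto simp: agree_def)
  qed
  have T: "T \<in> tilings P"
    unfolding tilings_def
  proof (intro CollectI conjI ballI impI)
    fix t assume "t \<in> T"
    then obtain n where "t \<in> \<tau> n" by (auto simp: T_def)
    then show "is_tile t" "translation_class t \<in> P" using tilingsD(1,2)[OF \<tau>] by auto
  next
    have "\<exists>t\<in>T. y \<in> fst t" for y
    proof -
      obtain n where n: "agree (norm y) (\<tau> n) T" using B[of "norm y"] by blast
      obtain t where "t \<in> \<tau> n" "y \<in> fst t" using tilingsD(3)[OF \<tau>] by blast
      then have "t \<in> patch (\<tau> n) 0 (norm y)" by (auto simp: patch_def)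
      then have "t \<in> T" using n by (auto simp: agree_def patch_def)
      then show ?thesis using \<open>y \<in> fst t\<close> ..
    qed
    then show "(\<Union>t\<in>T. fst t) = UNIV" by blast
  next
    fix t t' assume t: "t \<in> T" "t' \<in> T" "t \<noteq> t'"
    then obtain N N' where "\<forall>n\<ge>N. t \<in> \<tau> n" "\<forall>n\<ge>N'. t' \<in> \<tau> n" by (auto simp: T_def)
    then have "t \<in> \<tau> (max N N')" "t' \<in> \<tau> (max N N')" by auto
    then show "interior (fst t \<inter> fst t') = {}"
      by (rule tilingsD(4)[OF \<tau> _ _ t(3)])
  qed
  have "limitin mtopology \<sigma> (shift T (- l)) sequentially"
    unfolding limit_metric_sequentially
  proof (intro conjI allI impI)
    show "shift T (- l) \<in> tilings P" using T by simp
    fix \<epsilon> :: real assume \<epsilon>: "\<epsilon> > 0"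
    obtain N where N: "\<And>n. n \<ge> N \<Longrightarrow> agree (2 / \<epsilon> + norm l) (\<tau> n) T" using B by blast
    obtain N' where N': "\<And>n. n \<ge> N' \<Longrightarrow> norm (w n - l) < \<epsilon> / 2"
      using l \<epsilon> unfolding LIMSEQ_iff by (meson half_gt_zero)
    have "tiling_dist (\<sigma> n) (shift T (- l)) < \<epsilon>" if n: "n \<ge> max N N'" for n
    proof -
      have "agree (2 / \<epsilon>) (shift (\<tau> n) (- l)) (shift T (- l))"
        using n by (intro agree_shift[OF N]) auto
      then have "tiling_dist (\<sigma> n) (shift T (- l)) \<le> \<epsilon> / 2"
        using N'[of n] n \<epsilon> by (intro tiling_dist_le[of _ "w n - l" 0]) (auto simp: \<tau>_def)
      then show ?thesis using \<epsilon> by linarith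
    qed
    then show "\<exists>N. \<forall>n\<ge>N. \<sigma> n \<in> tilings P \<and> tiling_dist (\<sigma> n) (shift T (- l)) < \<epsilon>"
      using \<sigma> by blast
  qed
  then show "\<exists>T. limitin mtopology \<sigma> T sequentially" ..
qed

end

section \<open>Compactness of the hull\<close>

lemma finite_ball_cover:
  assumes "e > 0"
  shows "\<exists>F. finite F \<and> cball (0::'a::euclidean_space) C \<subseteq> (\<Union>f\<in>F. ball f e)"
  using compact_cball[of "0::'a" C] assms unfolding compact_eq_totally_bounded by blast

context prototiles
begin

text \<open>
  The hull consists of the tilings whose patches all occur in \<open>T0\<close>. This description makes
  translation invariance of the hull immediate.
\<close>

lemma tiling_hull_iff:
  assumes "T0 \<in> tilings P"
  shows "T \<in> tiling_hull P T0 \<longleftrightarrow> T \<in> tilings P \<and> (\<forall>r. \<exists>z. agree r T (shift T0 z))"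
proof -
  have "(\<forall>\<epsilon>>0. \<exists>z. tiling_dist T (shift T0 z) < \<epsilon>) \<longleftrightarrow> (\<forall>r. \<exists>z. agree r T (shift T0 z))"
  proof (intro iffI allI impI)
    fix r assume H: "\<forall>\<epsilon>>0. \<exists>z. tiling_dist T (shift T0 z) < \<epsilon>"
    obtain \<epsilon> :: real where \<epsilon>: "0 < \<epsilon>" "\<epsilon> \<le> 1 / sqrt 2" "\<epsilon> \<le> 1" "r + 2 \<le> 1 / \<epsilon> - \<epsilon>"
      using obtain_small_scale[of 1 "r + 2"] by auto
    obtain z where z: "tiling_dist T (shift T0 z) < \<epsilon>" using H \<epsilon>(1) by blast
    obtain w where w: "norm w \<le> 2 * \<epsilon>" "agree (1 / \<epsilon> - \<epsilon>) (shift T w) (shift T0 z)"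
      by (rule tiling_dist_less_imp_agree[OF z \<epsilon>(2)])
    have "agree r (shift (shift T w) (- w)) (shift (shift T0 z) (- w))"
      using w(1) \<epsilon> by (intro agree_shift[OF w(2)]) auto
    then show "\<exists>z. agree r T (shift T0 z)" by auto
  next
    fix \<epsilon> :: real assume H: "\<forall>r. \<exists>z. agree r T (shift T0 z)" and \<epsilon>: "\<epsilon> > 0"
    obtain z where "agree (2 / \<epsilon>) T (shift T0 z)" using H by blast
    then have "tiling_dist T (shift T0 z) \<le> \<epsilon> / 2"
      using \<epsilon> by (intro tiling_dist_le[of _ 0 0]) auto
    then show "\<exists>z. tiling_dist T (shift T0 z) < \<epsilon>" using \<epsilon> by (intro exI[of _ z]) linarith
  qed
  then show ?thesis
    using assms by (auto simp: tiling_hull_def metric_closure_of)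
qed

text \<open>
  Up to translation there are finitely many patches of radius \<open>R\<close>, represented by those at the
  finitely many points \<open>\<rho> x\<close>. The vectors \<open>v x + x\<close>, which carry the representative to the patch of
  \<open>shift T0 x\<close> about the origin, are bounded, because tiles are; so they can be rounded to a finite
  set \<open>F\<close>. Points with the same representative and the same rounded vector give nearby
  translates of \<open>T0\<close>.
\<close>

lemma FLC_imp_mtotally_bounded_orbit:
  assumes T0: "T0 \<in> tilings P" and "FLC T0"
  shows "mtotally_bounded (range (shift T0))"
  unfolding mtotally_bounded_def
proof (intro allI impI)
  fix e :: real assume "e > 0"
  define \<epsilon> where "\<epsilon> = e / 2"
  define R where "R = 1 / \<epsilon> + \<epsilon>"
  have \<epsilon>: "\<epsilon> > 0" "R > 0" using \<open>e > 0\<close> by (auto simp: \<epsilon>_def R_def add_pos_pos)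
  define cl where "cl x = range (shift (patch T0 x R))" for x
  have fin: "finite (range cl)"
    using \<open>FLC T0\<close> \<epsilon>(2) by (simp add: FLC_def cl_def)
  define \<rho> where "\<rho> x = (SOME y. cl y = cl x)" for x
  have \<rho>: "cl (\<rho> x) = cl x" for x
    unfolding \<rho>_def by (rule someI[of _ x]) simp
  have fin\<rho>: "finite (range \<rho>)"
  proof -
    have "range \<rho> = (\<lambda>c. SOME y. cl y = c) ` range cl"
      by (auto simp: \<rho>_def)
    then show ?thesis using fin by simp
  qed
  have "\<exists>v. patch T0 x R = shift (patch T0 (\<rho> x) R) v" for x
  proof -
    have "shift (patch T0 x R) 0 \<in> cl x" unfolding cl_def by (rule rangeI)
    then have "patch T0 x R \<in> cl (\<rho> x)" using \<rho>[of x] by simp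
    then show ?thesis unfolding cl_def by blast
  qed
  then obtain v where v: "\<And>x. patch T0 x R = shift (patch T0 (\<rho> x) R) (v x)" by metis
  have "\<exists>B. \<forall>x. \<rho> x = p \<longrightarrow> norm (v x + x) \<le> B" for p
  proof -
    obtain s where s: "s \<in> T0" "p \<in> fst s" using tilingsD(3)[OF T0] by blast
    have "p \<in> cball p R" using \<epsilon>(2) by simp
    then have sp: "s \<in> patch T0 p R" using s unfolding patch_def by blast
    have "compact (fst s)" using tilingsD(1)[OF T0 s(1)] by (simp add: is_tile_def)
    then obtain B where B: "\<And>y. y \<in> fst s \<Longrightarrow> norm y \<le> B"
      using compact_imp_bounded bounded_iff by metis
    have "norm (v x + x) \<le> B + R" if "\<rho> x = p" for x
    proof -
      have "shift_tile (v x) s \<in> patch T0 x R"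
        using v[of x] sp that by (auto simp: shift_def)
      then obtain y where y: "y \<in> fst s" "dist x (y - v x) \<le> R"
        by (auto simp: patch_def fst_shift_tile)
      have "norm (v x + x) \<le> norm y + dist x (y - v x)"
        using norm_triangle_ineq[of y "x - (y - v x)"] by (simp add: dist_norm algebra_simps)
      then show ?thesis using B[OF y(1)] y(2) by linarith
    qed
    then show ?thesis by blast
  qed
  then obtain B where B: "\<And>x. norm (v x + x) \<le> B (\<rho> x)" by metis
  define C where "C = Max (B ` range \<rho>)"
  have C: "v x + x \<in> cball 0 C" for x
  proof -
    have "B (\<rho> x) \<le> C"
      unfolding C_def using fin\<rho> by (intro Max_ge) auto
    then show ?thesis using B[of x] by simp
  qed
  obtain F where F: "finite F" "cball (0::'a) C \<subseteq> (\<Union>f\<in>F. ball f (\<epsilon> / 2))"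
    using finite_ball_cover[of "\<epsilon> / 2" C] \<epsilon>(1) by auto
  have "\<exists>f\<in>F. dist f (v x + x) < \<epsilon> / 2" for x
  proof -
    have "v x + x \<in> (\<Union>f\<in>F. ball f (\<epsilon> / 2))" using F(2) C[of x] by blast
    then show ?thesis unfolding UN_iff mem_ball .
  qed
  then obtain f where f: "\<And>x. f x \<in> F" "\<And>x. dist (f x) (v x + x) < \<epsilon> / 2" by metis
  define g where "g x = (\<rho> x, f x)" for x
  have close: "tiling_dist (shift T0 x) (shift T0 y) \<le> \<epsilon>" if "g x = g y" for x y
  proof -
    define \<delta> where "\<delta> = (v x + x) - (v y + y)"
    have "f x = f y" "\<rho> x = \<rho> y" using that by (auto simp: g_def)
    then have "dist (v x + x) (v y + y) \<le> \<epsilon>"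
      using f(2)[of x] f(2)[of y] dist_triangle3[of "v x + x" "v y + y" "f x"] by simp
    then have \<delta>: "norm \<delta> \<le> \<epsilon>" by (simp add: \<delta>_def dist_norm)
    have p: "patch (shift T0 z) 0 R = shift (patch T0 (\<rho> z) R) (v z + z)" for z
      using v[of z] by (simp add: patch_shift)
    have "patch (shift T0 x) 0 R = shift (patch (shift T0 y) 0 R) \<delta>"
      unfolding p using \<open>\<rho> x = \<rho> y\<close> by (simp add: \<delta>_def)
    then have "agree (1 / \<epsilon>) (shift T0 x) (shift (shift T0 y) \<delta>)"
      using \<delta> by (intro agree_of_patch_shift[of _ R]) (auto simp: R_def)
    then show ?thesis
      using \<epsilon>(1) \<delta> by (intro tiling_dist_le[of _ 0 \<delta>]) auto
  qed
  have "range g \<subseteq> range \<rho> \<times> F" using f(1) by (auto simp: g_def)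
  then have "finite (range g)" using fin\<rho> F(1) finite_subset by blast
  then obtain K where K: "finite K" "range g = g ` K"
    using finite_subset_image[of "range g" g UNIV] by auto
  have "\<exists>y\<in>K. tiling_dist (shift T0 y) (shift T0 x) < e" for x
  proof -
    obtain y where "y \<in> K" "g y = g x" using K(2) by (metis imageE rangeI)
    then show ?thesis using close[of y x] \<open>e > 0\<close> by (intro bexI[of _ y]) (auto simp: \<epsilon>_def)
  qed
  then show "\<exists>K. finite K \<and> K \<subseteq> range (shift T0) \<and> range (shift T0) \<subseteq> (\<Union>x\<in>K. mball x e)"
    using K(1) T0 by (intro exI[of _ "shift T0 ` K"]) auto
qed

end

locale FLC_hull = prototiles P \<kappa>
  for P :: "('a::euclidean_space, 'l) tile set set" and \<kappa> :: real +
  fixes T0 :: "('a, 'l) tiling" and \<Omega> :: "('a, 'l) tiling set"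
  assumes T0: "T0 \<in> tilings P" and FLC: "FLC T0" and hull: "\<Omega> = tiling_hull P T0"
begin

lemma hull_subset: "T \<in> \<Omega> \<Longrightarrow> T \<in> tilings P"
  using tiling_hull_iff[OF T0] hull by blast

lemma hull_agree: "T \<in> \<Omega> \<Longrightarrow> \<exists>z. agree r T (shift T0 z)"
  using tiling_hull_iff[OF T0] hull by blast

lemma shift_in_hull [simp]:
  assumes "T \<in> \<Omega>"
  shows "shift T x \<in> \<Omega>"
proof -
  have "\<exists>z. agree r (shift T x) (shift T0 z)" for r
  proof -
    obtain z where z: "agree (r + norm x) T (shift T0 z)" using hull_agree[OF assms] by blast
    have "agree r (shift T x) (shift (shift T0 z) x)"
      by (rule agree_shift[OF z]) simp
    then show ?thesis by auto
  qed
  then show ?thesis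
    using hull_subset[OF assms] tiling_hull_iff[OF T0] hull by simp
qed

lemma T0_in_hull: "T0 \<in> \<Omega>"
proof -
  have "agree r T0 (shift T0 0)" for r by simp
  then show ?thesis using T0 tiling_hull_iff[OF T0] hull by blast
qed

sublocale \<Omega>: Metric_space \<Omega> tiling_dist
  using hull_subset by (intro subspace) auto

lemma compact_hull: "compact_space \<Omega>.mtopology"
proof -
  interpret Submetric "tilings P" tiling_dist \<Omega>
    by unfold_locales (use hull_subset in auto)
  have "compactin mtopology (mtopology closure_of (range (shift T0)))"
    using mtotally_bounded_eq_compact_closure_of[OF mcomplete_tilings]
      FLC_imp_mtotally_bounded_orbit[OF T0 FLC] by blast
  then have "compactin mtopology \<Omega>"
    by (simp add: hull tiling_hull_def)
  then show ?thesis
    using mtopology_submetric by (simp add: compactin_subspace)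
qed

lemma mtotally_bounded_hull: "\<Omega>.mtotally_bounded \<Omega>"
  using compact_hull \<Omega>.compact_space_eq_mcomplete_mtotally_bounded by blast

end

section \<open>Homeomorphisms move orbits to orbits\<close>

locale hull_map = A: FLC_hull P \<kappa> T0 \<Omega> + B: FLC_hull P' \<kappa>' T0' \<Omega>'
  for P :: "('a::euclidean_space, 'l) tile set set" and \<kappa> T0 \<Omega>
    and P' :: "('a, 'm) tile set set" and \<kappa>' T0' \<Omega>' +
  fixes h :: "('a, 'l) tiling \<Rightarrow> ('a, 'm) tiling"
  assumes maps: "T \<in> \<Omega> \<Longrightarrow> h T \<in> \<Omega>'"
    and unif_cont: "\<epsilon> > 0 \<Longrightarrow> \<exists>\<delta>>0. \<forall>S\<in>\<Omega>. \<forall>T\<in>\<Omega>. tiling_dist S T < \<delta> \<longrightarrow> tiling_dist (h S) (h T) < \<epsilon>"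
begin

text \<open>
  A continuous path in a tiling space stays in one orbit, because transversally to the orbits the
  space is totally disconnected. In detail: on a small ball, \<open>x \<mapsto> h (shift T x)\<close>
  stays close to \<open>h T\<close> and has unique small displacements \<open>w x\<close> towards it. By the cocycle
  property the displaced tilings agree on a prescribed ball for nearby \<open>x\<close>; so their patches on
  each ball are locally constant in \<open>x\<close>, hence constant. At \<open>x = 0\<close> the displaced tiling is \<open>h T\<close>.
\<close>

lemma orbit_step:
  assumes "\<eta> > 0"
  shows "\<exists>\<delta>>0. \<forall>T\<in>\<Omega>. \<forall>x. norm x \<le> \<delta> \<longrightarrow> (\<exists>w. norm w \<le> \<eta> \<and> h (shift T x) = shift (h T) w)"
proof -
  \<comment> \<open>Three displacements, each of length at most \<open>2 * c\<close>, have to add up to less than \<open>\<kappa>'\<close>.\<close>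
  obtain c :: real where c: "0 < c" "c \<le> min (\<eta> / 2) (\<kappa>' / 7)" "c \<le> 1 / sqrt 2" "c \<le> 1" "2 \<le> 1 / c - c"
    using obtain_small_scale[of "min (\<eta> / 2) (\<kappa>' / 7)" 2] assms B.\<kappa>_pos by auto
  obtain \<delta>0 where \<delta>0: "\<delta>0 > 0"
    "\<And>S T. S \<in> \<Omega> \<Longrightarrow> T \<in> \<Omega> \<Longrightarrow> tiling_dist S T < \<delta>0 \<Longrightarrow> tiling_dist (h S) (h T) < c"
    using unif_cont[OF c(1)] by blast
  define \<delta> where "\<delta> = \<delta>0 / 2"
  have \<delta>: "\<delta> > 0" "\<delta> < \<delta>0" using \<delta>0(1) by (auto simp: \<delta>_def)
  have "\<exists>w. norm w \<le> \<eta> \<and> h (shift T x) = shift (h T) w" if T: "T \<in> \<Omega>" and x: "norm x \<le> \<delta>" for T x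
  proof -
    define \<gamma> where "\<gamma> x = h (shift T x)" for x
    have \<gamma>: "\<gamma> x \<in> tilings P'" for x
      unfolding \<gamma>_def using T maps B.hull_subset by simp
    have "\<exists>w. norm w \<le> 2 * c \<and> agree (1 / c - c) (shift (\<gamma> x) w) (\<gamma> 0)" if "x \<in> cball 0 \<delta>" for x
    proof -
      have "tiling_dist (shift T x) (shift T 0) \<le> norm x"
        using tiling_dist_shift[of "shift T x" "- x"] by simp
      then have "tiling_dist (\<gamma> x) (\<gamma> 0) < c"
        unfolding \<gamma>_def using that \<delta> T by (intro \<delta>0(2)) auto
      then show ?thesis by (rule tiling_dist_less_imp_agree[OF _ c(3)]) blast
    qed
    then obtain w where w: "\<And>x. x \<in> cball 0 \<delta> \<Longrightarrow> norm (w x) \<le> 2 * c"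
      "\<And>x. x \<in> cball 0 \<delta> \<Longrightarrow> agree (1 / c - c) (shift (\<gamma> x) (w x)) (\<gamma> 0)"
      by metis
    have loc: "\<exists>d>0. \<forall>y\<in>cball 0 \<delta>. dist y x < d \<longrightarrow>
        patch (shift (\<gamma> x) (w x)) 0 r = patch (shift (\<gamma> y) (w y)) 0 r"
      if x: "x \<in> cball 0 \<delta>" for x r
    proof -
      obtain \<epsilon> where \<epsilon>: "0 < \<epsilon>" "\<epsilon> \<le> c" "\<epsilon> \<le> 1 / sqrt 2" "\<epsilon> \<le> 1" "max (r + 2) 2 \<le> 1 / \<epsilon> - \<epsilon>"
        using obtain_small_scale[OF c(1), of "max (r + 2) 2"] by blast
      obtain d where d: "d > 0"
        "\<And>S T. S \<in> \<Omega> \<Longrightarrow> T \<in> \<Omega> \<Longrightarrow> tiling_dist S T < d \<Longrightarrow> tiling_dist (h S) (h T) < \<epsilon>"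
        using unif_cont[OF \<epsilon>(1)] by blast
      have "patch (shift (\<gamma> x) (w x)) 0 r = patch (shift (\<gamma> y) (w y)) 0 r"
        if y: "y \<in> cball 0 \<delta>" "dist y x < d" for y
      proof -
        have "tiling_dist (shift T x) (shift T y) \<le> norm (y - x)"
          using tiling_dist_shift[of "shift T x" "y - x"] by simp
        then have "tiling_dist (\<gamma> x) (\<gamma> y) < \<epsilon>"
          unfolding \<gamma>_def using y T by (intro d(2)) (auto simp: dist_norm)
        then obtain u where u: "norm u \<le> 2 * \<epsilon>" "agree (1 / \<epsilon> - \<epsilon>) (shift (\<gamma> x) u) (\<gamma> y)"
          by (rule tiling_dist_less_imp_agree[OF _ \<epsilon>(3)])
        have wxy: "norm (w x) \<le> 2 * c" "norm (w y) \<le> 2 * c" using w(1) x y by auto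
        have "2 * c \<le> 2" using c(4) by simp
        have "w x = u + w y"
        proof (rule B.displacement_add[OF \<gamma> \<gamma> \<gamma> w(2)[OF x] _ w(2)[OF y(1)] _ u(2)])
          show "0 \<le> 1 / c - c" "0 \<le> 1 / c - c" using c by auto
          show "norm (w y) \<le> 1 / \<epsilon> - \<epsilon>" using wxy \<epsilon> c by linarith
          show "norm (w x) + norm (w y) + norm u < \<kappa>'" using wxy u(1) \<epsilon> c B.\<kappa>_pos by linarith
        qed
        moreover have "agree r (shift (shift (\<gamma> x) u) (w y)) (shift (\<gamma> y) (w y))"
          using wxy \<epsilon> c by (intro agree_shift[OF u(2)]) auto
        ultimately show ?thesis by (simp add: agree_def)
      qed
      then show ?thesis using d(1) by blast
    qed
    have x': "x \<in> cball 0 \<delta>" "0 \<in> cball 0 \<delta>" using x \<delta> by auto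
    have ag: "agree r (shift (\<gamma> x) (w x)) (shift (\<gamma> 0) (w 0))" for r
    proof -
      have "\<forall>a\<in>cball 0 \<delta>. \<forall>\<^sub>F b in at a within cball 0 \<delta>.
          patch (shift (\<gamma> a) (w a)) 0 r = patch (shift (\<gamma> b) (w b)) 0 r"
        unfolding eventually_at using loc[of _ r] by meson
      then show ?thesis
        unfolding agree_def
        by (rule connected_local_const[where f = "\<lambda>x. patch (shift (\<gamma> x) (w x)) 0 r",
            OF connected_cball x'])
    qed
    have "norm (w 0) < \<kappa>'" using w(1)[OF x'(2)] c B.\<kappa>_pos by linarith
    moreover have "agree 0 (shift (\<gamma> 0) 0) (\<gamma> 0)" by simp
    ultimately have "w 0 = 0"
      using B.displacement_eq[OF \<gamma>[of 0] \<gamma>[of 0] w(2)[OF x'(2)], of 0 0] c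
      by simp
    have "shift (\<gamma> x) (w x) = shift (\<gamma> 0) (w 0)"
      using ag B.tile_nonempty[OF shift_in_tilings[OF \<gamma>]] by (intro agree_all_imp_eq) blast+
    then have "shift (shift (\<gamma> x) (w x)) (- w x) = shift (\<gamma> 0) (- w x)"
      using \<open>w 0 = 0\<close> by simp
    then have "h (shift T x) = shift (h T) (- w x)"
      by (simp add: \<gamma>_def)
    moreover have "norm (- w x) \<le> \<eta>" using w(1)[OF x'(1)] c by simp
    ultimately show ?thesis by blast
  qed
  then show ?thesis using \<delta>(1) by blast
qed

text \<open>
  A bounded translation is a bounded number of small ones.
\<close>

lemma orbit_bound:
  obtains K' where "K' \<ge> 0" "\<And>T x. T \<in> \<Omega> \<Longrightarrow> norm x \<le> K \<Longrightarrow> \<exists>y. norm y \<le> K' \<and> h (shift T x) = shift (h T) y"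
proof -
  obtain \<delta> where \<delta>: "\<delta> > 0" "\<And>T x. T \<in> \<Omega> \<Longrightarrow> norm x \<le> \<delta> \<Longrightarrow> \<exists>w. norm w \<le> 1 \<and> h (shift T x) = shift (h T) w"
    using orbit_step[of 1] by auto
  define n where "n = nat \<lceil>K / \<delta>\<rceil> + 1"
  have "K / \<delta> \<le> real n" unfolding n_def by (simp add: real_nat_ceiling_ge; linarith)
  then have n: "K \<le> real n * \<delta>" "n > 0" using \<delta>(1) by (simp_all add: field_simps n_def)
  have "\<exists>y. norm y \<le> real n \<and> h (shift T x) = shift (h T) y" if T: "T \<in> \<Omega>" and x: "norm x \<le> K" for T x
  proof -
    define s where "s = (1 / real n) *\<^sub>R x"
    have s: "norm s \<le> \<delta>" "real n *\<^sub>R s = x" using x n by (auto simp: s_def field_simps)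
    have "\<exists>y. norm y \<le> real i \<and> h (shift T (real i *\<^sub>R s)) = shift (h T) y" for i
    proof (induction i)
      case 0
      then show ?case by (intro exI[of _ 0]) simp
    next
      case (Suc i)
      then obtain y where y: "norm y \<le> real i" "h (shift T (real i *\<^sub>R s)) = shift (h T) y" by blast
      obtain w where "norm w \<le> 1" "h (shift (shift T (real i *\<^sub>R s)) s) = shift (h (shift T (real i *\<^sub>R s))) w"
        using \<delta>(2)[of "shift T (real i *\<^sub>R s)" s] T s by auto
      then show ?case
        using y norm_triangle_ineq[of y w] by (intro exI[of _ "y + w"]) (simp add: algebra_simps)
    qed
    from this[of n] show ?thesis using s(2) by simp
  qed
  then show ?thesis using that[of "real n"] by simp
qed

end

section \<open>Transport of agreement on large balls\<close>

locale hull_homeo = hull_map P \<kappa> T0 \<Omega> P' \<kappa>' T0' \<Omega>' h + inv: hull_map P' \<kappa>' T0' \<Omega>' P \<kappa> T0 \<Omega> g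
  for P :: "('a::euclidean_space, 'l) tile set set" and \<kappa> T0 \<Omega>
    and P' :: "('a, 'm) tile set set" and \<kappa>' T0' \<Omega>' and h g +
  assumes gh: "T \<in> \<Omega> \<Longrightarrow> g (h T) = T" and hg: "S \<in> \<Omega>' \<Longrightarrow> h (g S) = S"
begin

text \<open>
  Tilings that agree on a ball of radius \<open>R\<close> have images that agree, up to one small
  displacement \<open>w0\<close>, on a ball whose radius is linear in \<open>R\<close>. The image of \<open>T1\<close> is followed
  along the segment from \<open>0\<close> to \<open>y\<close> in steps \<open>s\<close>. The inverse map turns each step into a
  translation of \<open>T1\<close> by at most \<open>1\<close>, so the position \<open>x\<close> in \<open>T1\<close> stays where \<open>T1\<close> and
  \<open>T2\<close> still agree; there uniform continuity makes the images close, with some displacement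
  \<open>w\<close>. The total offset between the two images changes by less than \<open>\<kappa>'\<close> from one step to the
  next, so rigidity forces it to keep its initial value \<open>w0\<close>.
\<close>

lemma agree_image:
  "\<exists>a b. a > 0 \<and> (\<forall>T1\<in>\<Omega>. \<forall>T2\<in>\<Omega>. \<forall>R. agree R T1 T2 \<longrightarrow>
      (\<exists>w. norm w \<le> 1 \<and> agree (a * R - b) (shift (h T1) w) (h T2)))"
proof -
  define k where "k = min 1 (\<kappa>' / 20)"
  have k: "0 < k" "k \<le> 1" "k \<le> \<kappa>' / 20" using B.\<kappa>_pos by (auto simp: k_def)
  obtain c :: real where c: "0 < c" "c \<le> k" "c \<le> 1 / sqrt 2" "c \<le> 1" "4 \<le> 1 / c - c"
    using obtain_small_scale[OF k(1), of 4] by blast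
  have "4 * c \<le> 1 - c * c" using c(1,5) by (simp add: field_simps)
  then have c2: "4 * c \<le> 1" using zero_le_square[of c] by linarith
  obtain \<delta>0 where \<delta>0: "\<delta>0 > 0"
    "\<And>S T. S \<in> \<Omega> \<Longrightarrow> T \<in> \<Omega> \<Longrightarrow> tiling_dist S T < \<delta>0 \<Longrightarrow> tiling_dist (h S) (h T) < c"
    using unif_cont[OF c(1)] by blast
  define r0 where "r0 = 2 / \<delta>0"
  have r0: "r0 > 0" using \<delta>0(1) by (simp add: r0_def)
  have near: "\<exists>w. norm w \<le> 2 * c \<and> agree (1 / c - c) (shift (h S) w) (h T)"
    if "S \<in> \<Omega>" "T \<in> \<Omega>" "agree r0 S T" for S T
  proof -
    have "tiling_dist S T \<le> \<delta>0 / 2"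
      using that(3) \<delta>0(1) by (intro tiling_dist_le[of _ 0 0]) (auto simp: r0_def)
    then have "tiling_dist (h S) (h T) < c" using \<delta>0 that by simp
    then show ?thesis by (rule tiling_dist_less_imp_agree[OF _ c(3)]) blast
  qed
  \<comment> \<open>A step in \<open>\<Omega>\<close> of length at most \<open>\<delta>h\<close> is seen in \<open>\<Omega>'\<close> as a step of length at most \<open>k\<close>; a
  step in \<open>\<Omega>'\<close> of length at most \<open>\<delta>g\<close> is seen in \<open>\<Omega>\<close> as one that satisfies the former bound.\<close>
  obtain \<delta>h where \<delta>h: "\<delta>h > 0"
    "\<And>T x. T \<in> \<Omega> \<Longrightarrow> norm x \<le> \<delta>h \<Longrightarrow> \<exists>w. norm w \<le> k \<and> h (shift T x) = shift (h T) w"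
    using orbit_step[OF k(1)] by blast
  obtain \<delta>g where \<delta>g: "\<delta>g > 0"
    "\<And>S y. S \<in> \<Omega>' \<Longrightarrow> norm y \<le> \<delta>g \<Longrightarrow> \<exists>v. norm v \<le> min \<delta>h 1 \<and> g (shift S y) = shift (g S) v"
    using inv.orbit_step[of "min \<delta>h 1"] \<delta>h(1) by auto
  define d where "d = min \<delta>g k"
  have d: "0 < d" "d \<le> \<delta>g" "d \<le> k" using \<delta>g(1) k(1) by (auto simp: d_def)
  have "\<exists>w. norm w \<le> 1 \<and> agree (d * R - d * (1 + r0)) (shift (h T1) w) (h T2)"
    if T: "T1 \<in> \<Omega>" "T2 \<in> \<Omega>" and R: "agree R T1 T2" for T1 T2 R
  proof (cases "R < 1 + r0")
    case True
    then have "d * R - d * (1 + r0) < 0" using d(1) by simp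
    then show ?thesis using agree_negative_radius[of "d * R - d * (1 + r0)"] by (intro exI[of _ 0]) simp
  next
    case False
    have "agree r0 T1 T2" by (rule agree_mono[OF R]) (use False in simp)
    then obtain w0 where w0: "norm w0 \<le> 2 * c" "agree (1 / c - c) (shift (h T1) w0) (h T2)"
      using near[OF T] by blast
    have hT: "h T1 \<in> \<Omega>'" "h T2 \<in> \<Omega>'" "h T1 \<in> tilings P'" "h T2 \<in> tilings P'"
      using T maps B.hull_subset by auto
    have "agree 0 (shift (shift (h T1) w0) y) (shift (h T2) y)"
      if y: "norm y \<le> d * R - d * (1 + r0)" for y
    proof -
      define n where "n = nat \<lceil>norm y / d\<rceil>"
      define s where "s = (1 / real n) *\<^sub>R y"
      have nd: "norm y / d \<le> real n" by (simp add: n_def real_nat_ceiling_ge)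
      then have "norm y \<le> real n * d" using d(1) by (simp add: field_simps)
      then have s: "norm s \<le> d" "real n *\<^sub>R s = y"
        using d(1) by (cases "n = 0"; simp add: s_def field_simps)+
      have "real n \<le> norm y / d + 1"
        unfolding n_def using d(1) by (simp add: of_nat_nat; linarith)
      moreover have "norm y / d \<le> R - (1 + r0)"
        using y d(1) by (simp add: field_simps)
      \<comment> \<open>Each of the \<open>n\<close> steps moves the position in \<open>T1\<close> by at most \<open>1\<close>, so a ball of radius \<open>r0\<close> about
      it still lies in the region of agreement.\<close>
      ultimately have nR: "real n + r0 \<le> R" by linarith
      \<comment> \<open>The last conjunct is the invariant: the offset between the two images is always \<open>w0\<close>.\<close>
      have "\<exists>x z w. norm x \<le> real i \<and> h (shift T1 x) = shift (h T1) (real i *\<^sub>R s)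
          \<and> h (shift T2 x) = shift (h T2) z \<and> norm w \<le> 2 * c
          \<and> agree (1 / c - c) (shift (h T1) (real i *\<^sub>R s + w)) (shift (h T2) z)
          \<and> z = real i *\<^sub>R s + w - w0" if "i \<le> n" for i
        using that
      proof (induction i)
        case 0
        then show ?case using w0 by (intro exI[of _ 0] exI[of _ w0]) simp
      next
        case (Suc i)
        then obtain x z w where IH: "norm x \<le> real i" "h (shift T1 x) = shift (h T1) (real i *\<^sub>R s)"
          "h (shift T2 x) = shift (h T2) z" "norm w \<le> 2 * c"
          "agree (1 / c - c) (shift (h T1) (real i *\<^sub>R s + w)) (shift (h T2) z)"
          "z = real i *\<^sub>R s + w - w0" by auto
        have "shift (h T1) (real i *\<^sub>R s) \<in> \<Omega>'" using hT by simp
        then obtain v where v: "norm v \<le> min \<delta>h 1"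
          "g (shift (shift (h T1) (real i *\<^sub>R s)) s) = shift (g (shift (h T1) (real i *\<^sub>R s))) v"
          using \<delta>g(2)[of _ s] s(1) d(2) by (meson order_trans)
        have "g (shift (h T1) (real i *\<^sub>R s)) = shift T1 x"
          using IH(2) gh[of "shift T1 x"] T by simp
        then have "g (shift (h T1) (real (Suc i) *\<^sub>R s)) = shift T1 (x + v)"
          using v(2) by (simp add: algebra_simps)
        then have h1: "h (shift T1 (x + v)) = shift (h T1) (real (Suc i) *\<^sub>R s)"
          using hg[of "shift (h T1) (real (Suc i) *\<^sub>R s)"] hT by simp
        obtain \<zeta> where \<zeta>: "norm \<zeta> \<le> k" "h (shift (shift T2 x) v) = shift (h (shift T2 x)) \<zeta>"
          using \<delta>h(2)[of "shift T2 x" v] T v(1) by auto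
        then have h2: "h (shift T2 (x + v)) = shift (h T2) (z + \<zeta>)" using IH(3) by simp
        have nx: "norm (x + v) \<le> real (Suc i)"
          using IH(1) v(1) norm_triangle_ineq[of x v] by simp
        have "agree r0 (shift T1 (x + v)) (shift T2 (x + v))"
          using nx Suc.prems nR by (intro agree_shift[OF R]) linarith
        then obtain w' where w': "norm w' \<le> 2 * c"
          "agree (1 / c - c) (shift (shift (h T1) (real (Suc i) *\<^sub>R s)) w') (shift (h T2) (z + \<zeta>))"
          using near[of "shift T1 (x + v)" "shift T2 (x + v)"] T h1 h2 by auto
        \<comment> \<open>The offset after the step; it has to be compared with \<open>w0\<close>.\<close>
        define o' where "o' = real (Suc i) *\<^sub>R s + w' - (z + \<zeta>)"
        have "agree 0 (shift (shift (h T1) (real i *\<^sub>R s + w)) \<zeta>) (shift (shift (h T2) z) \<zeta>)"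
          using \<zeta>(1) k c by (intro agree_shift[OF IH(5)]) simp
        moreover have "real i *\<^sub>R s + w + \<zeta> = w0 + (z + \<zeta>)" using IH(6) by simp
        ultimately have ag: "agree 0 (shift (h T1) (w0 + (z + \<zeta>))) (shift (h T2) (z + \<zeta>))" by simp
        have ag': "agree (1 / c - c) (shift (h T1) (o' + (z + \<zeta>))) (shift (h T2) (z + \<zeta>))"
          using w'(2) by (simp add: o'_def)
        have eq: "w0 + (z + \<zeta>) - (o' + (z + \<zeta>)) = w - w' + (\<zeta> - s)"
          using IH(6) by (simp add: o'_def algebra_simps)
        have "norm (w - w' + (\<zeta> - s)) \<le> (norm w + norm w') + (norm \<zeta> + norm s)"
          by (intro norm_triangle_mono norm_triangle_ineq4)
        then have "norm (w0 + (z + \<zeta>) - (o' + (z + \<zeta>))) < \<kappa>'"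
          unfolding eq using IH(4) w'(1) \<zeta>(1) s(1) d c k B.\<kappa>_pos by linarith
        then have "w0 + (z + \<zeta>) = o' + (z + \<zeta>)"
          using B.displacement_eq[OF shift_in_tilings[OF hT(4)] hT(3) ag order_refl ag'] c by simp
        then have "z + \<zeta> = real (Suc i) *\<^sub>R s + w' - w0" by (simp add: o'_def algebra_simps)
        then show ?case
          using nx h1 h2 w' by (intro exI[of _ "x + v"] exI[of _ "z + \<zeta>"] exI[of _ w']) simp
      qed
      then obtain z w where zw: "norm w \<le> 2 * c"
          "agree (1 / c - c) (shift (h T1) (y + w)) (shift (h T2) z)" "z = y + w - w0"
        using s(2) by (metis order_refl)
      have "agree 0 (shift (shift (h T1) (y + w)) (w0 - w)) (shift (shift (h T2) z) (w0 - w))"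
        using zw(1) w0(1) c c2 norm_triangle_ineq4[of w0 w]
        by (intro agree_shift[OF zw(2)]) linarith
      then show ?thesis using zw(3) by (simp add: algebra_simps)
    qed
    then have "agree (d * R - d * (1 + r0)) (shift (h T1) w0) (h T2)"
      by (rule agree_pointwise)
    then show ?thesis using w0(1) c2 by (intro exI[of _ w0]) simp
  qed
  then show ?thesis using d(1) by blast
qed

end

section \<open>Covers by sets of bounded diameter\<close>

definition diam_cover :: "'b set \<Rightarrow> ('b \<Rightarrow> 'b \<Rightarrow> real) \<Rightarrow> real \<Rightarrow> 'b set set \<Rightarrow> bool" where
  "diam_cover X d \<delta> \<U> \<longleftrightarrow> finite \<U> \<and> \<Union>\<U> = X \<and> (\<forall>U\<in>\<U>. \<forall>x\<in>U. \<forall>y\<in>U. d x y \<le> \<delta>)"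

lemma covering_number_eq: "covering_number X d \<delta> = (LEAST n. \<exists>\<U>. diam_cover X d \<delta> \<U> \<and> card \<U> = n)"
  unfolding covering_number_def diam_cover_def by (rule arg_cong[of _ _ Least]) auto

lemma covering_number_le: "diam_cover X d \<delta> \<U> \<Longrightarrow> covering_number X d \<delta> \<le> card \<U>"
  unfolding covering_number_eq by (rule Least_le) auto

lemma covering_number_attained:
  assumes "diam_cover X d \<delta> \<V>"
  shows "\<exists>\<U>. diam_cover X d \<delta> \<U> \<and> card \<U> = covering_number X d \<delta>"
  unfolding covering_number_eq by (rule LeastI[of _ "card \<V>"]) (use assms in auto)

section \<open>Pointing rules and transversals\<close>

locale pointed_hull = FLC_hull P \<kappa> T0 \<Omega>
  for P :: "('a::euclidean_space, 'l) tile set set" and \<kappa> T0 \<Omega> +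
  fixes D :: "('a, 'l) tiling \<Rightarrow> 'a set"
  assumes pointing: "local_pointing_rule \<Omega> D"
begin

abbreviation "\<Xi> \<equiv> canonical_transversal \<Omega> D"

lemma \<Xi>_iff: "T \<in> \<Xi> \<longleftrightarrow> T \<in> \<Omega> \<and> 0 \<in> D T"
  by (simp add: canonical_transversal_def)

lemma mem_D_shift_iff:
  assumes "T \<in> \<Omega>"
  shows "z \<in> D (shift T x) \<longleftrightarrow> z + x \<in> D T"
proof -
  have "D (shift T x) = (\<lambda>y. y - x) ` D T"
    using pointing assms by (simp add: local_pointing_rule_def)
  then show ?thesis by (force simp: algebra_simps)
qed

text \<open>
  Equivariance spreads locality from the origin to balls of any radius.
\<close>

lemma D_local:
  obtains R where "R > 0" "\<And>T T' r y. T \<in> \<Omega> \<Longrightarrow> T' \<in> \<Omega> \<Longrightarrow> agree (r + R) T T' \<Longrightarrow> norm y \<le> r \<Longrightarrow>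
    y \<in> D T \<longleftrightarrow> y \<in> D T'"
proof -
  obtain \<rho> R where R: "\<rho> > 0" "R > 0" and loc: "\<And>T T'. T \<in> \<Omega> \<Longrightarrow> T' \<in> \<Omega> \<Longrightarrow>
      patch T 0 R = patch T' 0 R \<Longrightarrow> D T \<inter> cball 0 \<rho> = D T' \<inter> cball 0 \<rho>"
  proof -
    have "\<exists>\<rho>>0. \<exists>R>0. \<forall>T\<in>\<Omega>. \<forall>T'\<in>\<Omega>.
        patch T 0 R = patch T' 0 R \<longrightarrow> D T \<inter> cball 0 \<rho> = D T' \<inter> cball 0 \<rho>"
      using pointing unfolding local_pointing_rule_def by (elim conjE)
    then show ?thesis using that by (elim exE conjE) metis
  qed
  have "y \<in> D T \<longleftrightarrow> y \<in> D T'" if T: "T \<in> \<Omega>" "T' \<in> \<Omega>" and ag: "agree (r + R) T T'" "norm y \<le> r" for T T' r y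
  proof -
    have "agree R (shift T y) (shift T' y)"
      using ag(2) by (intro agree_shift[OF ag(1)]) simp
    then have "D (shift T y) \<inter> cball 0 \<rho> = D (shift T' y) \<inter> cball 0 \<rho>"
      using T by (intro loc) (auto simp: agree_def)
    moreover have "0 \<in> cball (0::'a) \<rho>" using R by simp
    ultimately have "0 \<in> D (shift T y) \<longleftrightarrow> 0 \<in> D (shift T' y)" by blast
    then show ?thesis using T by (simp add: mem_D_shift_iff)
  qed
  then show ?thesis using that R(2) by blast
qed

text \<open>
  Two points of \<open>D T\<close> lie in a patch that occurs in \<open>T0\<close>; so the separation constant for \<open>T0\<close>
  serves the whole hull.
\<close>

lemma D_separated:
  obtains e where "e > 0" "\<And>T y z. T \<in> \<Omega> \<Longrightarrow> y \<in> D T \<Longrightarrow> z \<in> D T \<Longrightarrow> dist y z < e \<Longrightarrow> y = z"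
proof -
  obtain R where R: "R > 0" "\<And>T T' r y. T \<in> \<Omega> \<Longrightarrow> T' \<in> \<Omega> \<Longrightarrow> agree (r + R) T T' \<Longrightarrow> norm y \<le> r \<Longrightarrow>
    y \<in> D T \<longleftrightarrow> y \<in> D T'" using D_local by blast
  have "uniform_discrete (D T0)"
    using pointing T0_in_hull by (simp add: local_pointing_rule_def Delaunay_def)
  then obtain e where e: "e > 0" "\<And>x y. x \<in> D T0 \<Longrightarrow> y \<in> D T0 \<Longrightarrow> dist x y < e \<Longrightarrow> x = y"
    unfolding uniform_discrete_def by blast
  have "y = z" if T: "T \<in> \<Omega>" and yz: "y \<in> D T" "z \<in> D T" "dist y z < e" for T y z
  proof -
    obtain u where u: "agree (max (norm y) (norm z) + R) T (shift T0 u)"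
      using hull_agree[OF T] by blast
    have "y \<in> D (shift T0 u)" "z \<in> D (shift T0 u)"
      using R(2)[OF T shift_in_hull[OF T0_in_hull] u] yz by auto
    then have "y + u \<in> D T0" "z + u \<in> D T0" using T0_in_hull by (auto simp: mem_D_shift_iff)
    moreover have "dist (y + u) (z + u) < e" using yz(3) by simp
    ultimately show ?thesis using e(2) by fastforce
  qed
  then show ?thesis using that e(1) by blast
qed

lemma D_relatively_dense:
  obtains K where "\<And>T. T \<in> \<Omega> \<Longrightarrow> \<exists>y\<in>D T. norm y \<le> K"
proof -
  obtain R where R: "R > 0" "\<And>T T' r y. T \<in> \<Omega> \<Longrightarrow> T' \<in> \<Omega> \<Longrightarrow> agree (r + R) T T' \<Longrightarrow> norm y \<le> r \<Longrightarrow>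
    y \<in> D T \<longleftrightarrow> y \<in> D T'" using D_local by blast
  have "Delaunay (D T0)"
    using pointing T0_in_hull by (simp add: local_pointing_rule_def)
  then obtain K where K: "\<And>x. \<exists>y\<in>D T0. dist x y \<le> K"
    unfolding Delaunay_def by blast
  have "\<exists>y\<in>D T. norm y \<le> K" if T: "T \<in> \<Omega>" for T
  proof -
    obtain u where u: "agree (K + R) T (shift T0 u)"
      using hull_agree[OF T] by blast
    obtain p where p: "p \<in> D T0" "dist u p \<le> K" using K by blast
    have np: "norm (p - u) \<le> K" using p(2) by (simp add: dist_norm norm_minus_commute)
    have "p - u \<in> D (shift T0 u)" using p(1) T0_in_hull by (simp add: mem_D_shift_iff)
    then have "p - u \<in> D T" using R(2)[OF T shift_in_hull[OF T0_in_hull] u np] by simp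
    then show ?thesis using np by blast
  qed
  then show ?thesis using that by blast
qed

text \<open>
  A ball of diameter less than the separation constant contains at most one point of \<open>D T\<close>, so
  the size of a finite cover by such balls bounds the number of points.
\<close>

lemma D_card_bound:
  obtains M :: nat where "M > 0" "\<And>T. T \<in> \<Omega> \<Longrightarrow> finite (D T \<inter> cball 0 L) \<and> card (D T \<inter> cball 0 L) \<le> M"
proof -
  obtain e where e: "e > 0" "\<And>T y z. T \<in> \<Omega> \<Longrightarrow> y \<in> D T \<Longrightarrow> z \<in> D T \<Longrightarrow> dist y z < e \<Longrightarrow> y = z"
    using D_separated by blast
  obtain F where F: "finite F" "cball (0::'a) L \<subseteq> (\<Union>f\<in>F. ball f (e / 2))"
    using finite_ball_cover[of "e / 2" L] e(1) by auto
  have *: "finite (D T \<inter> cball 0 L) \<and> card (D T \<inter> cball 0 L) \<le> card F + 1" if T: "T \<in> \<Omega>" for T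
  proof -
    have "\<exists>f. f \<in> F \<and> y \<in> ball f (e / 2)" if "y \<in> cball 0 L" for y
      using F(2) that by blast
    then obtain f where f: "\<And>y. y \<in> cball 0 L \<Longrightarrow> f y \<in> F" "\<And>y. y \<in> cball 0 L \<Longrightarrow> y \<in> ball (f y) (e / 2)"
      by metis
    have inj: "inj_on f (D T \<inter> cball 0 L)"
    proof (rule inj_onI)
      fix y z assume yz: "y \<in> D T \<inter> cball 0 L" "z \<in> D T \<inter> cball 0 L" "f y = f z"
      then have "dist (f y) y < e / 2" "dist (f y) z < e / 2" using f(2)[of y] f(2)[of z] by auto
      then have "dist y z < e" using dist_triangle_half_r[of "f y" y e z] by simp
      then show "y = z" using e(2)[OF T] yz by blast
    qed
    have sub: "f ` (D T \<inter> cball 0 L) \<subseteq> F" using f(1) by blast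
    show ?thesis
      using card_inj_on_le[OF inj sub F(1)] inj_on_finite[OF inj sub F(1)] by simp
  qed
  show ?thesis by (rule that[OF _ *]) simp
qed

text \<open>
  On the transversal no displacement is needed. If \<open>w\<close> displaces \<open>T1\<close> to \<open>T2\<close>, then \<open>w\<close> belongs to
  \<open>D T1\<close> by locality, as does \<open>0\<close>; being small, \<open>w\<close> vanishes by separation. So on the transversal the
  distance records, up to constants, the inverse of the radius of exact agreement.
\<close>

lemma transversal_close_imp_agree:
  obtains \<delta>1 where "\<delta>1 > 0" "\<And>\<delta> T1 T2. 0 < \<delta> \<Longrightarrow> \<delta> < \<delta>1 \<Longrightarrow> T1 \<in> \<Xi> \<Longrightarrow> T2 \<in> \<Xi> \<Longrightarrow>
    tiling_dist T1 T2 \<le> \<delta> \<Longrightarrow> agree (1 / (4 * \<delta>)) T1 T2"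
proof -
  obtain R where R: "R > 0" "\<And>T T' r y. T \<in> \<Omega> \<Longrightarrow> T' \<in> \<Omega> \<Longrightarrow> agree (r + R) T T' \<Longrightarrow> norm y \<le> r \<Longrightarrow>
    y \<in> D T \<longleftrightarrow> y \<in> D T'" using D_local by blast
  obtain e where e: "e > 0" "\<And>T y z. T \<in> \<Omega> \<Longrightarrow> y \<in> D T \<Longrightarrow> z \<in> D T \<Longrightarrow> dist y z < e \<Longrightarrow> y = z"
    using D_separated by blast
  define \<delta>1 where "\<delta>1 = min (min (1 / 4) (e / 4)) (1 / (4 * R))"
  have \<delta>1: "\<delta>1 > 0" "\<delta>1 \<le> 1 / 4" "\<delta>1 \<le> e / 4" "\<delta>1 \<le> 1 / (4 * R)" using e(1) R(1) by (auto simp: \<delta>1_def)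
  have "agree (1 / (4 * \<delta>)) T1 T2"
    if \<delta>: "0 < \<delta>" "\<delta> < \<delta>1" and T: "T1 \<in> \<Xi>" "T2 \<in> \<Xi>" "tiling_dist T1 T2 \<le> \<delta>" for \<delta> T1 T2
  proof -
    have "sqrt 2 \<le> 2" using real_le_lsqrt[of 2 2] by simp
    then have "1 / 2 \<le> 1 / sqrt 2" by (simp add: field_simps)
    then have c: "2 * \<delta> \<le> 1 / sqrt 2" using \<delta> \<delta>1 by linarith
    have d: "tiling_dist T1 T2 < 2 * \<delta>" using T(3) \<delta> by simp
    obtain w where w: "norm w \<le> 2 * (2 * \<delta>)" "agree (1 / (2 * \<delta>) - 2 * \<delta>) (shift T1 w) T2"
      by (rule tiling_dist_less_imp_agree[OF d c])
    have "\<delta> \<le> 1 / 4" using \<delta> \<delta>1 by linarith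
    then have "1 \<le> 1 / (4 * \<delta>)" "2 * \<delta> \<le> 1" using \<delta>(1) by (auto simp: field_simps)
    moreover have "1 / (2 * \<delta>) = 1 / (4 * \<delta>) + 1 / (4 * \<delta>)" using \<delta>(1) by (simp add: field_simps)
    ultimately have r: "1 / (4 * \<delta>) \<le> 1 / (2 * \<delta>) - 2 * \<delta>" by linarith
    have "\<delta> \<le> 1 / (4 * R)" using \<delta> \<delta>1(4) by linarith
    then have "R \<le> 1 / (4 * \<delta>)" using \<delta>(1) R(1) by (simp add: field_simps)
    then have "agree (0 + R) (shift T1 w) T2" using agree_mono[OF w(2)] r by simp
    then have "0 \<in> D (shift T1 w)" using R(2)[of "shift T1 w" T2 0 0] T by (simp add: \<Xi>_iff)
    then have "w \<in> D T1" using T by (simp add: \<Xi>_iff mem_D_shift_iff)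
    moreover have "dist w 0 < e" using w(1) \<delta> \<delta>1(3) by simp
    ultimately have "w = 0" using e(2)[of T1 w 0] T by (simp add: \<Xi>_iff)
    then show ?thesis using agree_mono[OF w(2) r] by simp
  qed
  then show ?thesis using that \<delta>1(1) by blast
qed

text \<open>
  Total boundedness of the hull supplies a finite cover, so the least cardinality is attained.
\<close>

lemma transversal_cover_attained:
  assumes "\<delta> > 0"
  shows "\<exists>\<U>. diam_cover \<Xi> tiling_dist \<delta> \<U> \<and> card \<U> = covering_number \<Xi> tiling_dist \<delta>"
proof -
  obtain K where K: "finite K" "\<Omega> \<subseteq> (\<Union>x\<in>K. \<Omega>.mball x (\<delta> / 2))"
    using mtotally_bounded_hull assms unfolding \<Omega>.mtotally_bounded_def by (meson half_gt_zero)
  define \<V> where "\<V> = (\<lambda>x. \<Xi> \<inter> \<Omega>.mball x (\<delta> / 2)) ` K"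
  have "\<Union>\<V> = \<Xi>" using K(2) by (auto simp: \<V>_def \<Xi>_iff)
  moreover have "tiling_dist x y \<le> \<delta>" if xy: "U \<in> \<V>" "x \<in> U" "y \<in> U" for U x y
  proof -
    obtain z where "tiling_dist z x < \<delta> / 2" "tiling_dist z y < \<delta> / 2"
      using xy unfolding \<V>_def by auto
    then show ?thesis
      using tiling_dist_triangle[of x y z] tiling_dist_commute[of x z] by linarith
  qed
  moreover have "finite \<V>" using K(1) by (simp add: \<V>_def)
  ultimately have "diam_cover \<Xi> tiling_dist \<delta> \<V>" by (simp add: diam_cover_def)
  then show ?thesis by (rule covering_number_attained)
qed

lemma transversal_nonempty: "\<Xi> \<noteq> {}"
proof -
  obtain K where "\<And>T. T \<in> \<Omega> \<Longrightarrow> \<exists>y\<in>D T. norm y \<le> K" using D_relatively_dense by blast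
  then obtain y where "y \<in> D T0" using T0_in_hull by blast
  then have "shift T0 y \<in> \<Xi>" using T0_in_hull by (simp add: \<Xi>_iff mem_D_shift_iff)
  then show ?thesis by blast
qed

lemma covering_number_pos:
  assumes "\<delta> > 0"
  shows "covering_number \<Xi> tiling_dist \<delta> \<ge> 1"
proof -
  obtain \<U> where \<U>: "finite \<U>" "card \<U> = covering_number \<Xi> tiling_dist \<delta>" "\<Union>\<U> = \<Xi>"
    using transversal_cover_attained[OF assms] by (auto simp: diam_cover_def)
  then have "\<U> \<noteq> {}" using transversal_nonempty by auto
  then show ?thesis using \<U> card_gt_0_iff[of \<U>] by simp
qed

end

section \<open>Comparison of covering numbers\<close>

locale pointed_hull_homeo =
  hull_homeo P \<kappa> T0 \<Omega> P' \<kappa>' T0' \<Omega>' h g +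
  A: pointed_hull P \<kappa> T0 \<Omega> D + B: pointed_hull P' \<kappa>' T0' \<Omega>' D'
  for P :: "('a::euclidean_space, 'l) tile set set" and \<kappa> T0 \<Omega>
    and P' :: "('a, 'm) tile set set" and \<kappa>' T0' \<Omega>' and h g D D'
begin

text \<open>
  From a cover of the source transversal by sets of diameter \<open>\<delta> / C\<close> choose a representative in
  each set. All tilings \<open>T\<close> in the set agree with it on a ball of radius \<open>R\<close> proportional to
  \<open>C / \<delta>\<close>. A point of the target transversal is a bounded translate of \<open>h T\<close> for some \<open>T\<close> in the
  source transversal; so it agrees, on a ball of radius \<open>1 / \<delta>\<close>, with the image of the
  representative translated by a bounded vector. By locality this vector belongs to the point set
  of that image, which leaves at most \<open>M\<close> choices. Each choice defines a set of diameter at most \<open>\<delta>\<close>.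
\<close>

lemma covering_number_transfer:
  obtains M C \<delta>1 :: real where "M > 0" "C > 0" "\<delta>1 > 0"
    "\<And>\<delta>. 0 < \<delta> \<Longrightarrow> \<delta> < \<delta>1 \<Longrightarrow>
      real (covering_number B.\<Xi> tiling_dist \<delta>) \<le> M * real (covering_number A.\<Xi> tiling_dist (\<delta> / C))"
proof -
  obtain a b where ab: "a > 0" "\<And>T1 T2 R. T1 \<in> \<Omega> \<Longrightarrow> T2 \<in> \<Omega> \<Longrightarrow> agree R T1 T2 \<Longrightarrow>
      \<exists>w. norm w \<le> 1 \<and> agree (a * R - b) (shift (h T1) w) (h T2)"
    using agree_image by blast
  obtain \<delta>A where \<delta>A: "\<delta>A > 0" "\<And>\<delta> T1 T2. 0 < \<delta> \<Longrightarrow> \<delta> < \<delta>A \<Longrightarrow> T1 \<in> A.\<Xi> \<Longrightarrow> T2 \<in> A.\<Xi> \<Longrightarrow>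
    tiling_dist T1 T2 \<le> \<delta> \<Longrightarrow> agree (1 / (4 * \<delta>)) T1 T2"
    using A.transversal_close_imp_agree by blast
  obtain K1 where K1: "\<And>T. T \<in> \<Omega> \<Longrightarrow> \<exists>y\<in>D T. norm y \<le> K1"
    using A.D_relatively_dense by blast
  obtain K2 where K2: "K2 \<ge> 0" "\<And>T x. T \<in> \<Omega> \<Longrightarrow> norm x \<le> K1 \<Longrightarrow> \<exists>y. norm y \<le> K2 \<and> h (shift T x) = shift (h T) y"
    using orbit_bound[of K1] by blast
  obtain R' where R': "R' > 0" "\<And>S S' r y. S \<in> \<Omega>' \<Longrightarrow> S' \<in> \<Omega>' \<Longrightarrow> agree (r + R') S S' \<Longrightarrow> norm y \<le> r \<Longrightarrow>
    y \<in> D' S \<longleftrightarrow> y \<in> D' S'" using B.D_local by blast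
  obtain M where M: "M > 0" "\<And>S. S \<in> \<Omega>' \<Longrightarrow> finite (D' S \<inter> cball 0 (K2 + 1)) \<and> card (D' S \<inter> cball 0 (K2 + 1)) \<le> M"
    using B.D_card_bound by blast
  \<comment> \<open>With \<open>R = C / (4 * \<delta>)\<close> this gives \<open>a * R = 1 / \<delta> + 1 / \<delta>\<close>; one half is the radius of
  agreement that is needed, the other absorbs the constants.\<close>
  define C where "C = 8 / a"
  define \<delta>1 where "\<delta>1 = min (\<delta>A * C) (1 / (\<bar>b\<bar> + K2 + R'))"
  have C: "C > 0" using ab(1) by (simp add: C_def)
  have pos: "\<bar>b\<bar> + K2 + R' > 0" using R'(1) K2(1) by linarith
  have \<delta>1: "\<delta>1 > 0" using \<delta>A(1) C pos by (simp add: \<delta>1_def)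
  have "covering_number B.\<Xi> tiling_dist \<delta> \<le> M * covering_number A.\<Xi> tiling_dist (\<delta> / C)"
    if \<delta>: "0 < \<delta>" "\<delta> < \<delta>1" for \<delta>
  proof -
    have \<delta>C: "0 < \<delta> / C" "\<delta> / C < \<delta>A" using \<delta> C by (auto simp: \<delta>1_def field_simps)
    define R where "R = 1 / (4 * (\<delta> / C))"
    have "\<delta> < 1 / (\<bar>b\<bar> + K2 + R')" using \<delta> by (simp add: \<delta>1_def)
    then have "\<bar>b\<bar> + K2 + R' \<le> 1 / \<delta>" using \<delta>(1) pos by (simp add: field_simps)
    moreover have "a * R = 1 / \<delta> + 1 / \<delta>"
      using ab(1) \<delta>(1) by (simp add: R_def C_def field_simps)
    moreover have "1 / \<delta> > 0" using \<delta>(1) by simp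
    ultimately have R: "1 / \<delta> + K2 \<le> a * R - b" "R' + K2 \<le> a * R - b" using K2(1) R'(1) by linarith+
    obtain \<U> where \<U>: "finite \<U>" "card \<U> = covering_number A.\<Xi> tiling_dist (\<delta> / C)" "\<Union>\<U> = A.\<Xi>"
      "\<And>U x y. U \<in> \<U> \<Longrightarrow> x \<in> U \<Longrightarrow> y \<in> U \<Longrightarrow> tiling_dist x y \<le> \<delta> / C"
      using A.transversal_cover_attained[OF \<delta>C(1)] unfolding diam_cover_def by metis
    define rep where "rep U = (SOME T. T \<in> U)" for U :: "('a, 'l) tiling set"
    define \<W> where "\<W> = \<U> - {{}}"
    have rep: "rep U \<in> U" "rep U \<in> A.\<Xi>" "rep U \<in> \<Omega>" if "U \<in> \<W>" for U
    proof -
      show "rep U \<in> U" using that by (simp add: rep_def some_in_eq \<W>_def)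
      then show "rep U \<in> A.\<Xi>" using that \<U>(3) unfolding \<W>_def by blast
      then show "rep U \<in> \<Omega>" by (simp add: A.\<Xi>_iff)
    qed
    define I where "I = (SIGMA U:\<W>. D' (h (rep U)) \<inter> cball 0 (K2 + 1))"
    define V where "V = (\<lambda>(U, z). {S \<in> B.\<Xi>. agree (1 / \<delta>) (shift (h (rep U)) z) S})"
    have finI: "finite I"
      unfolding I_def using \<U>(1) M(2) maps rep(3) by (intro finite_SigmaI) (auto simp: \<W>_def)
    have "card I = (\<Sum>U\<in>\<W>. card (D' (h (rep U)) \<inter> cball 0 (K2 + 1)))"
      unfolding I_def using \<U>(1) M(2) maps rep(3) by (intro card_SigmaI) (auto simp: \<W>_def)
    also have "\<dots> \<le> card \<W> * M"
      using M(2) maps rep(3) by (intro sum_bounded_above[of _ _ M, simplified]) auto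
    also have "\<dots> \<le> card \<U> * M"
      using card_mono[OF \<U>(1), of \<W>] by (simp add: \<W>_def)
    finally have cardI: "card I \<le> card \<U> * M" .
    have diam: "tiling_dist x y \<le> \<delta>" if xy: "U \<in> V ` I" "x \<in> U" "y \<in> U" for U x y
    proof -
      have "agree (1 / \<delta>) x y" using xy agree_sym agree_trans unfolding V_def by fast
      then show ?thesis using \<delta>(1) by (intro tiling_dist_le[of _ 0 0]) auto
    qed
    have "S \<in> \<Union>(V ` I)" if S: "S \<in> B.\<Xi>" for S
    proof -
      have S': "S \<in> \<Omega>'" "0 \<in> D' S" using S by (auto simp: B.\<Xi>_iff)
      have gS: "g S \<in> \<Omega>" using inv.maps[OF S'(1)] .
      obtain p where p: "p \<in> D (g S)" "norm p \<le> K1" using K1[OF gS] by blast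
      define T where "T = shift (g S) p"
      have T: "T \<in> A.\<Xi>" "T \<in> \<Omega>" using p gS by (auto simp: T_def A.\<Xi>_iff A.mem_D_shift_iff)
      obtain y where y: "norm y \<le> K2" "h (shift T (- p)) = shift (h T) y"
        using K2(2)[OF T(2), of "- p"] p(2) by auto
      then have Sy: "S = shift (h T) y" using hg[OF S'(1)] by (simp add: T_def)
      obtain U where U: "U \<in> \<W>" "T \<in> U" using T(1) \<U>(3) unfolding \<W>_def by blast
      have "tiling_dist (rep U) T \<le> \<delta> / C"
        using \<U>(4) U rep(1)[OF U(1)] unfolding \<W>_def by blast
      then have "agree R (rep U) T"
        unfolding R_def by (rule \<delta>A(2)[OF \<delta>C rep(2)[OF U(1)] T(1)])
      then obtain w where w: "norm w \<le> 1" "agree (a * R - b) (shift (h (rep U)) w) (h T)"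
        using ab(2)[OF rep(3)[OF U(1)] T(2)] by blast
      have ag: "agree r (shift (h (rep U)) (w + y)) S" if "r + K2 \<le> a * R - b" for r
      proof -
        have "agree r (shift (shift (h (rep U)) w) y) (shift (h T) y)"
          using that y(1) by (intro agree_shift[OF w(2)]) simp
        then show ?thesis using Sy by simp
      qed
      have hU: "h (rep U) \<in> \<Omega>'" using maps rep(3)[OF U(1)] .
      have "agree (0 + R') (shift (h (rep U)) (w + y)) S" using ag[OF R(2)] by simp
      then have "0 \<in> D' (shift (h (rep U)) (w + y))"
        using R'(2)[of "shift (h (rep U)) (w + y)" S 0 0] hU S' by simp
      then have "w + y \<in> D' (h (rep U))" using hU by (simp add: B.mem_D_shift_iff)
      moreover have "norm (w + y) \<le> K2 + 1" using w(1) y(1) norm_triangle_ineq[of w y] by linarith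
      ultimately have "(U, w + y) \<in> I" using U(1) by (simp add: I_def)
      moreover have "S \<in> V (U, w + y)" using S ag[OF R(1)] by (simp add: V_def)
      ultimately show ?thesis by blast
    qed
    then have "\<Union>(V ` I) = B.\<Xi>" by (auto simp: V_def)
    then have "diam_cover B.\<Xi> tiling_dist \<delta> (V ` I)"
      using finI diam unfolding diam_cover_def by blast
    then have "covering_number B.\<Xi> tiling_dist \<delta> \<le> card (V ` I)"
      by (rule covering_number_le)
    also have "\<dots> \<le> card I" using finI by (rule card_image_le)
    finally show ?thesis using cardI \<U>(2) by (simp add: mult.commute)
  qed
  then have "\<And>\<delta>. 0 < \<delta> \<Longrightarrow> \<delta> < \<delta>1 \<Longrightarrow>
      real (covering_number B.\<Xi> tiling_dist \<delta>) \<le> real M * real (covering_number A.\<Xi> tiling_dist (\<delta> / C))"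
    by (metis of_nat_le_iff of_nat_mult)
  then show ?thesis using that[of "real M" C \<delta>1] M(1) C \<delta>1 by simp
qed

end

section \<open>Box-counting dimension\<close>

text \<open>
  Rescaling \<open>\<delta>\<close> by a constant changes \<open>ln \<delta>\<close> by a bounded amount, while \<open>ln \<delta>\<close> itself is
  unbounded; the same holds for the added constant \<open>k\<close>. The limit \<open>L\<close> may be infinite.
\<close>

lemma log_ratio_rescale:
  fixes f :: "real \<Rightarrow> real"
  assumes lim: "((\<lambda>\<delta>. ereal (ln (f \<delta>) / (- ln \<delta>))) \<longlongrightarrow> L) (at_right 0)" and c: "c > 0"
  shows "((\<lambda>\<delta>. ereal ((ln (f (c * \<delta>)) + k) / (- ln \<delta>))) \<longlongrightarrow> L) (at_right 0)"
proof -
  have scale: "filterlim (\<lambda>\<delta>. c * \<delta>) (at_right 0) (at_right (0::real))"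
    unfolding filterlim_at
    using c by (auto intro!: tendsto_eq_intros eventually_at_right_less[THEN eventually_mono])
  have small: "((\<lambda>\<delta>::real. a / ln \<delta>) \<longlongrightarrow> 0) (at_right 0)" for a :: real
    by (rule tendsto_divide_0[OF tendsto_const filterlim_at_bot_imp_at_infinity[OF ln_at_0]])
  have "((\<lambda>\<delta>. ereal (1 + ln c / ln \<delta>)) \<longlongrightarrow> ereal (1 + 0)) (at_right 0)"
    by (intro tendsto_intros small)
  moreover have "((\<lambda>\<delta>. ereal (ln (f (c * \<delta>)) / (- ln (c * \<delta>)))) \<longlongrightarrow> L) (at_right 0)"
    by (rule filterlim_compose[OF lim scale])
  ultimately have "((\<lambda>\<delta>. ereal (1 + ln c / ln \<delta>) * ereal (ln (f (c * \<delta>)) / (- ln (c * \<delta>))))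
      \<longlongrightarrow> ereal (1 + 0) * L) (at_right 0)"
    by (rule tendsto_mult_ereal) (simp add: one_ereal_def[symmetric])
  moreover have "((\<lambda>\<delta>. ereal (- k / ln \<delta>)) \<longlongrightarrow> ereal 0) (at_right 0)"
    by (intro tendsto_intros small)
  ultimately have "((\<lambda>\<delta>. ereal (1 + ln c / ln \<delta>) * ereal (ln (f (c * \<delta>)) / (- ln (c * \<delta>))) + ereal (- k / ln \<delta>))
      \<longlongrightarrow> ereal (1 + 0) * L + ereal 0) (at_right 0)"
    by (rule tendsto_add_ereal_general[rotated]) simp
  then have lim': "((\<lambda>\<delta>. ereal (1 + ln c / ln \<delta>) * ereal (ln (f (c * \<delta>)) / (- ln (c * \<delta>))) + ereal (- k / ln \<delta>))
      \<longlongrightarrow> L) (at_right 0)"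
    by (simp add: one_ereal_def[symmetric] zero_ereal_def[symmetric])
  have "\<forall>\<^sub>F \<delta> in at_right 0. \<delta> < min 1 (1 / c)"
    using c by (intro order_tendstoD(2)[OF tendsto_ident_at]) simp
  then have "\<forall>\<^sub>F \<delta> in at_right 0.
      ereal (1 + ln c / ln \<delta>) * ereal (ln (f (c * \<delta>)) / (- ln (c * \<delta>))) + ereal (- k / ln \<delta>)
      = ereal ((ln (f (c * \<delta>)) + k) / (- ln \<delta>))"
    using eventually_at_right_less[of "0::real"]
  proof eventually_elim
    case (elim \<delta>)
    then have "c * \<delta> < 1" using c by (simp add: field_simps)
    then have "ln \<delta> < 0" "ln (c * \<delta>) < 0"
      using elim c by (auto simp del: ln_mult simp: ln_less_zero)
    moreover from this have "1 + ln c / ln \<delta> = ln (c * \<delta>) / ln \<delta>"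
      using elim c by (simp add: ln_mult field_simps)
    moreover have "b / a * (F / - b) + - k / a = (F + k) / - a" if "a < 0" "b < 0" for a b F :: real
      using that by (simp add: field_simps)
    ultimately show ?case by simp
  qed
  then show ?thesis by (rule Lim_transform_eventually[OF lim'])
qed

text \<open>
  After taking logarithms, both hypotheses bound the ratio for \<open>Y\<close>, from above and from below, by
  rescaled ratios for \<open>X\<close> that have the same limit.
\<close>

lemma box_ratio_limit_transfer:
  fixes X :: "'b set" and Y :: "'c set"
  assumes "\<And>\<delta>. 0 < \<delta> \<Longrightarrow> 1 \<le> covering_number X d \<delta>" "\<And>\<delta>. 0 < \<delta> \<Longrightarrow> 1 \<le> covering_number Y e \<delta>"
    and upper: "M > 0" "C > 0" "\<delta>1 > 0" "\<And>\<delta>. 0 < \<delta> \<Longrightarrow> \<delta> < \<delta>1 \<Longrightarrow>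
      real (covering_number Y e \<delta>) \<le> M * real (covering_number X d (\<delta> / C))"
    and lower: "M' > 0" "C' > 0" "\<delta>2 > 0" "\<And>\<delta>. 0 < \<delta> \<Longrightarrow> \<delta> < \<delta>2 \<Longrightarrow>
      real (covering_number X d \<delta>) \<le> M' * real (covering_number Y e (\<delta> / C'))"
    and lim: "(box_ratio X d \<longlongrightarrow> L) (at_right 0)"
  shows "(box_ratio Y e \<longlongrightarrow> L) (at_right 0)"
proof -
  have lim': "((\<lambda>\<delta>. ereal (ln (real (covering_number X d \<delta>)) / (- ln \<delta>))) \<longlongrightarrow> L) (at_right 0)"
    using lim by (simp add: box_ratio_def[abs_def])
  have ev: "\<forall>\<^sub>F \<delta> in at_right 0. \<delta> < min (min 1 \<delta>1) (\<delta>2 / C')"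
    using upper(3) lower(2,3) by (intro order_tendstoD(2)[OF tendsto_ident_at]) simp
  have above: "\<forall>\<^sub>F \<delta> in at_right 0. box_ratio Y e \<delta> \<le>
      ereal ((ln (real (covering_number X d (1 / C * \<delta>))) + ln M) / (- ln \<delta>))"
    using ev eventually_at_right_less[of "0::real"]
  proof eventually_elim
    case (elim \<delta>)
    have x: "1 \<le> covering_number X d (\<delta> / C)" using assms(1)[of "\<delta> / C"] elim upper(2) by simp
    have y: "1 \<le> covering_number Y e \<delta>" using assms(2) elim by simp
    have "ln (real (covering_number Y e \<delta>)) \<le> ln (M * real (covering_number X d (\<delta> / C)))"
      using upper(4)[of \<delta>] y elim by (intro ln_mono) auto
    also have "\<dots> = ln (real (covering_number X d (\<delta> / C))) + ln M"
      using x upper(1) by (simp add: ln_mult)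
    finally show ?case
      using elim by (simp add: box_ratio_def divide_right_mono_neg)
  qed
  have below: "\<forall>\<^sub>F \<delta> in at_right 0.
      ereal ((ln (real (covering_number X d (C' * \<delta>))) + - ln M') / (- ln \<delta>)) \<le> box_ratio Y e \<delta>"
    using ev eventually_at_right_less[of "0::real"]
  proof eventually_elim
    case (elim \<delta>)
    have x: "1 \<le> covering_number X d (C' * \<delta>)" using assms(1)[of "C' * \<delta>"] elim lower(2) by simp
    have y: "1 \<le> covering_number Y e \<delta>" using assms(2) elim by simp
    have "C' * \<delta> < \<delta>2" using elim lower(2) by (simp add: field_simps)
    then have "ln (real (covering_number X d (C' * \<delta>))) \<le> ln (M' * real (covering_number Y e \<delta>))"
      using lower(4)[of "C' * \<delta>"] lower(2) x elim by (intro ln_mono) auto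
    also have "\<dots> = ln (real (covering_number Y e \<delta>)) + ln M'"
      using y lower(1) by (simp add: ln_mult)
    finally have "ln (real (covering_number X d (C' * \<delta>))) + - ln M' \<le> ln (real (covering_number Y e \<delta>))"
      by simp
    then show ?case
      using elim unfolding box_ratio_def ereal_less_eq by (intro divide_right_mono) auto
  qed
  have "1 / C > 0" using upper(2) by simp
  then show ?thesis
    by (rule tendsto_sandwich[OF below above log_ratio_rescale[OF lim' lower(2)] log_ratio_rescale[OF lim']])
qed

text \<open>
  Compactness of the hull makes continuous maps uniformly continuous.
\<close>

lemma hull_map_of_continuous_map:
  assumes "FLC_hull P \<kappa> T0 \<Omega>" "FLC_hull P' \<kappa>' T0' \<Omega>'"
    and cont: "continuous_map (Metric_space.mtopology \<Omega> tiling_dist)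
          (Metric_space.mtopology \<Omega>' tiling_dist) h"
  shows "hull_map P \<kappa> T0 \<Omega> P' \<kappa>' T0' \<Omega>' h"
proof -
  interpret A: FLC_hull P \<kappa> T0 \<Omega> by fact
  interpret B: FLC_hull P' \<kappa>' T0' \<Omega>' by fact
  have "uniformly_continuous_map (metric (\<Omega>, tiling_dist)) (metric (\<Omega>', tiling_dist)) h"
    using cont A.compact_hull
    by (subst continuous_eq_uniformly_continuous_map[symmetric]) simp_all
  then have "h \<in> \<Omega> \<rightarrow> \<Omega>'" and "\<forall>\<epsilon>>0. \<exists>\<delta>>0. \<forall>S\<in>\<Omega>. \<forall>T\<in>\<Omega>.
      tiling_dist T S < \<delta> \<longrightarrow> tiling_dist (h T) (h S) < \<epsilon>"
    unfolding uniformly_continuous_map_def by simp_all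
  then show ?thesis
    by unfold_locales (blast, metis)
qed

lemma tiling_space_FLC_hull:
  assumes "finite_prototile_set P" "aperiodic_repetitive_FLC_tiling_space P \<Omega>"
  obtains \<kappa> T0 where "FLC_hull P \<kappa> T0 \<Omega>"
proof -
  obtain \<kappa> where "rigid \<kappa> (tilings P)" using tilings_rigid[OF assms(1)] by blast
  then show ?thesis
    using assms(2) that unfolding aperiodic_repetitive_FLC_tiling_space_def
    by (auto simp: FLC_hull_def FLC_hull_axioms_def prototiles_def)
qed

theorem corollary3p4:
  fixes P :: "('a::euclidean_space, 'l) tile set set"
    and P' :: "('a, 'm) tile set set"
    and \<Omega> :: "('a, 'l) tiling set"
    and \<Omega>' :: "('a, 'm) tiling set"
    and D :: "('a, 'l) tiling \<Rightarrow> 'a set"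
    and D' :: "('a, 'm) tiling \<Rightarrow> 'a set"
  assumes "finite_prototile_set P"
    and "finite_prototile_set P'"
    and "aperiodic_repetitive_FLC_tiling_space P \<Omega>"
    and "aperiodic_repetitive_FLC_tiling_space P' \<Omega>'"
    and "Metric_space.mtopology \<Omega> tiling_dist homeomorphic_space
         Metric_space.mtopology \<Omega>' tiling_dist"
    and "local_pointing_rule \<Omega> D"
    and "local_pointing_rule \<Omega>' D'"
  shows "(box_dim_exists (canonical_transversal \<Omega> D) tiling_dist \<longleftrightarrow>
          box_dim_exists (canonical_transversal \<Omega>' D') tiling_dist) \<and>
         (box_dim_exists (canonical_transversal \<Omega> D) tiling_dist \<longrightarrow>
          box_dim (canonical_transversal \<Omega> D) tiling_dist =
          box_dim (canonical_transversal \<Omega>' D') tiling_dist)"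
proof -
  obtain \<kappa> T0 where A: "FLC_hull P \<kappa> T0 \<Omega>"
    by (rule tiling_space_FLC_hull[OF assms(1,3)])
  obtain \<kappa>' T0' where B: "FLC_hull P' \<kappa>' T0' \<Omega>'"
    by (rule tiling_space_FLC_hull[OF assms(2,4)])
  interpret A: FLC_hull P \<kappa> T0 \<Omega> by fact
  interpret B: FLC_hull P' \<kappa>' T0' \<Omega>' by fact
  obtain h g where hg: "homeomorphic_maps (Metric_space.mtopology \<Omega> tiling_dist)
      (Metric_space.mtopology \<Omega>' tiling_dist) h g"
    using assms(5) unfolding homeomorphic_space_def by blast
  interpret h: hull_map P \<kappa> T0 \<Omega> P' \<kappa>' T0' \<Omega>' h
    by (rule hull_map_of_continuous_map[OF A B]) (use hg in \<open>simp add: homeomorphic_maps_def\<close>)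
  interpret g: hull_map P' \<kappa>' T0' \<Omega>' P \<kappa> T0 \<Omega> g
    by (rule hull_map_of_continuous_map[OF B A]) (use hg in \<open>simp add: homeomorphic_maps_def\<close>)
  have inv: "\<And>T. T \<in> \<Omega> \<Longrightarrow> g (h T) = T" "\<And>S. S \<in> \<Omega>' \<Longrightarrow> h (g S) = S"
    using hg by (auto simp: homeomorphic_maps_def)
  interpret hg: pointed_hull_homeo P \<kappa> T0 \<Omega> P' \<kappa>' T0' \<Omega>' h g D D'
    by unfold_locales (use inv assms in auto)
  interpret gh: pointed_hull_homeo P' \<kappa>' T0' \<Omega>' P \<kappa> T0 \<Omega> g h D' D
    by unfold_locales (use inv assms in auto)
  let ?X = "canonical_transversal \<Omega> D" and ?Y = "canonical_transversal \<Omega>' D'"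
  obtain M C \<delta>1 where 1: "M > 0" "C > 0" "\<delta>1 > 0" "\<And>\<delta>. 0 < \<delta> \<Longrightarrow> \<delta> < \<delta>1 \<Longrightarrow>
      real (covering_number ?Y tiling_dist \<delta>) \<le> M * real (covering_number ?X tiling_dist (\<delta> / C))"
    using hg.covering_number_transfer by blast
  obtain M' C' \<delta>2 where 2: "M' > 0" "C' > 0" "\<delta>2 > 0" "\<And>\<delta>. 0 < \<delta> \<Longrightarrow> \<delta> < \<delta>2 \<Longrightarrow>
      real (covering_number ?X tiling_dist \<delta>) \<le> M' * real (covering_number ?Y tiling_dist (\<delta> / C'))"
    using gh.covering_number_transfer by blast
  have iff: "(box_ratio ?X tiling_dist \<longlongrightarrow> L) (at_right 0) \<longleftrightarrow>
      (box_ratio ?Y tiling_dist \<longlongrightarrow> L) (at_right 0)" for L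
    using box_ratio_limit_transfer[OF hg.A.covering_number_pos hg.B.covering_number_pos 1 2]
      box_ratio_limit_transfer[OF hg.B.covering_number_pos hg.A.covering_number_pos 2 1] by blast
  have "box_dim ?X tiling_dist = L \<and> box_dim ?Y tiling_dist = L"
    if "(box_ratio ?X tiling_dist \<longlongrightarrow> L) (at_right 0)" for L
    using that iff[of L] unfolding box_dim_def by (auto intro!: tendsto_Lim)
  then show ?thesis
    unfolding box_dim_exists_def using iff by metis
qed

end
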